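(* Let $k \geq 1$ be an integer. A graph is maximal ambiguously $k$-colorable if and only if it is isomorphic to $G(A)$ for some desirable $k \times k$-matrix $A$.
   Context: All graphs are finite and simple. An anticlique of a graph $G$ is a set of pairwise nonadjacent vertices of $G$. A $k$-coloring of $G$ is a partition of $V(G)$ (into nonempty classes) into at most $k$ anticliques. A graph is ambiguously $k$-colorable if it has more than one $k$-coloring (i.e. at least two distinct such partitions). A graph is maximal ambiguously $k$-colorable if it is ambiguously $k$-colorable but adding any edge between two distinct nonadjacent vertices produces a graph which is not ambiguously $k$-colorable. Let $A$ be a $k \times k$-matrix all of whose entries are non-negative integers. - $A$ is tiny if it is a diagonal matrix with exactly one (diagonal) entry equal to $2$, all other entries at most $1$, and at least two diagonal entries equal to $0$. - $A$ is small if it is a diagonal matrix with at least one entry equal to $2$, all others at most $2$, and exactly one diagonal entry equal to $0$. - $A$ is special if all diagonal entries are nonzero, exactly one off-diagonal entry is $1$, and all other off-diagonal entries are $0$. - $A$ is normal if it is a block diagonal matrix $\begin{pmatrix} M & 0 \\ 0 & D\end{pmatrix}$ with diagonal blocks $M, D$, where $D$ is a diagonal matrix with all diagonal entries nonzero ($D$ may be empty, i.e. of size $0$), and $M$ has the following two properties: (i) all diagonal entries of $M$ are nonzero; (ii) $M$ is of size $r \times r$ with $r \geq 2$ and is fully indecomposable, that is, there is no $s \in \{1,\dots,r-1\}$ such that $M$ has an $s \times (r-s)$ zero submatrix (a submatrix being given by an arbitrary set of $s$ rows and an arbitrary set of $r-s$ columns). - $A$ is desirable if it is tiny or small or special or normal.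 For a $k\times k$-matrix $A$ with non-negative integer entries, $G(A)$ is the graph on vertex set $\{(i,j,t) : i,j \in \{1,\dots,k\},\ t \in \{1,\dots,A(i,j)\}\}$, where $(i,j,t)$ and $(i',j',t')$ are adjacent if and only if $i \neq i'$ and $j \neq j'$. *)

theory Defs
  imports "Graph_Theory.Graph_Theory" "Jordan_Normal_Form.Matrix" "HOL-Library.Disjoint_Sets"
begin

text \<open>
  A finite simple graph is a \<^const>\<open>pair_graph\<close>, i.e. a finite, loop-free, symmetric digraph
  whose arcs are ordered pairs; an edge between \<open>u\<close> and \<open>v\<close> is the pair of arcs
  \<open>(u, v)\<close>, \<open>(v, u)\<close>.
\<close>

definition anticlique :: "'a pair_pre_digraph \<Rightarrow> 'a set \<Rightarrow> bool" where
  "anticlique G S \<longleftrightarrow> S \<subseteq> pverts G \<and> (\<forall>u\<in>S. \<forall>v\<in>S. (u, v) \<notin> parcs G)"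

definition coloring :: "nat \<Rightarrow> 'a pair_pre_digraph \<Rightarrow> 'a set set \<Rightarrow> bool" where
  "coloring k G P \<longleftrightarrow>
     partition_on (pverts G) P \<and> finite P \<and> card P \<le> k \<and> (\<forall>S\<in>P. anticlique G S)"

definition ambiguously_colorable :: "nat \<Rightarrow> 'a pair_pre_digraph \<Rightarrow> bool" where
  "ambiguously_colorable k G \<longleftrightarrow> (\<exists>P Q. coloring k G P \<and> coloring k G Q \<and> P \<noteq> Q)"

definition add_edge :: "'a pair_pre_digraph \<Rightarrow> 'a \<Rightarrow> 'a \<Rightarrow> 'a pair_pre_digraph" where
  "add_edge G u v = \<lparr>pverts = pverts G, parcs = parcs G \<union> {(u, v), (v, u)}\<rparr>"

definition maximal_ambiguously_colorable :: "nat \<Rightarrow> 'a pair_pre_digraph \<Rightarrow> bool" where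
  "maximal_ambiguously_colorable k G \<longleftrightarrow>
     ambiguously_colorable k G \<and>
     (\<forall>u\<in>pverts G. \<forall>v\<in>pverts G. u \<noteq> v \<and> (u, v) \<notin> parcs G \<longrightarrow>
        \<not> ambiguously_colorable k (add_edge G u v))"

text \<open>
  The predicates below are meant for square matrices. Rows and columns are indexed from \<open>0\<close>.
\<close>

definition tiny :: "nat mat \<Rightarrow> bool" where
  "tiny A \<longleftrightarrow> diagonal_mat A \<and>
     (\<exists>i<dim_row A. A $$ (i, i) = 2 \<and> (\<forall>j<dim_row A. j \<noteq> i \<longrightarrow> A $$ (j, j) \<le> 1)) \<and>
     card {i. i < dim_row A \<and> A $$ (i, i) = 0} \<ge> 2"

definition small :: "nat mat \<Rightarrow> bool" where
  "small A \<longleftrightarrow> diagonal_mat A \<and>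
     (\<exists>i<dim_row A. A $$ (i, i) = 2) \<and>
     (\<forall>i<dim_row A. A $$ (i, i) \<le> 2) \<and>
     card {i. i < dim_row A \<and> A $$ (i, i) = 0} = 1"

definition special :: "nat mat \<Rightarrow> bool" where
  "special A \<longleftrightarrow> (\<forall>i<dim_row A. A $$ (i, i) \<noteq> 0) \<and>
     (\<exists>i<dim_row A. \<exists>j<dim_col A. i \<noteq> j \<and> A $$ (i, j) = 1 \<and>
        (\<forall>i'<dim_row A. \<forall>j'<dim_col A. i' \<noteq> j' \<and> (i', j') \<noteq> (i, j) \<longrightarrow> A $$ (i', j') = 0))"

definition has_zero_submatrix :: "nat mat \<Rightarrow> nat \<Rightarrow> nat \<Rightarrow> bool" where
  "has_zero_submatrix M p q \<longleftrightarrow>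
     (\<exists>I J. I \<subseteq> {..<dim_row M} \<and> J \<subseteq> {..<dim_col M} \<and> card I = p \<and> card J = q \<and>
        (\<forall>i\<in>I. \<forall>j\<in>J. M $$ (i, j) = 0))"

definition fully_indecomposable :: "nat mat \<Rightarrow> bool" where
  "fully_indecomposable M \<longleftrightarrow>
     \<not> (\<exists>s\<in>{1..dim_row M - 1}. has_zero_submatrix M s (dim_row M - s))"

text \<open>The block \<open>D\<close> may be empty (\<open>s = 0\<close>).\<close>

definition normal :: "nat mat \<Rightarrow> bool" where
  "normal A \<longleftrightarrow>
     (\<exists>r s M D. M \<in> carrier_mat r r \<and> D \<in> carrier_mat s s \<and>
        A = four_block_mat M (0\<^sub>m r s) (0\<^sub>m s r) D \<and>
        diagonal_mat D \<and> (\<forall>i<s. D $$ (i, i) \<noteq> 0) \<and>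
        (\<forall>i<r. M $$ (i, i) \<noteq> 0) \<and> r \<ge> 2 \<and> fully_indecomposable M)"

definition desirable :: "nat mat \<Rightarrow> bool" where
  "desirable A \<longleftrightarrow> tiny A \<or> small A \<or> special A \<or> normal A"

definition mat_graph_verts :: "nat mat \<Rightarrow> (nat \<times> nat \<times> nat) set" where
  "mat_graph_verts A = {(i, j, t). i < dim_row A \<and> j < dim_col A \<and> t \<in> {1..A $$ (i, j)}}"

definition mat_graph :: "nat mat \<Rightarrow> (nat \<times> nat \<times> nat) pair_pre_digraph" where
  "mat_graph A =
     \<lparr>pverts = mat_graph_verts A,
      parcs = {((i, j, t), (i', j', t')) | i j t i' j' t'.
                 (i, j, t) \<in> mat_graph_verts A \<and> (i', j', t') \<in> mat_graph_verts A \<and>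
                 i \<noteq> i' \<and> j \<noteq> j'}\<rparr>"

lemma pair_graph_mat_graph: "pair_graph (mat_graph A)"
proof -
  have "mat_graph_verts A \<subseteq>
      (\<Union>i<dim_row A. \<Union>j<dim_col A. (\<lambda>t. (i, j, t)) ` {1..A $$ (i, j)})"
    by (fastforce simp: mat_graph_verts_def image_iff)
  then have fin: "finite (mat_graph_verts A)"
    by (rule finite_subset) auto
  have sub: "parcs (mat_graph A) \<subseteq> mat_graph_verts A \<times> mat_graph_verts A"
    by (auto simp: mat_graph_def)
  have "finite (parcs (mat_graph A))"
    using sub fin by (meson finite_SigmaI finite_subset)
  then show ?thesis
    using fin by unfold_locales (auto simp: mat_graph_def symmetric_def sym_def)
qed

lemma pair_graph_add_edge:
  assumes "pair_graph G" "u \<in> pverts G" "v \<in> pverts G" "u \<noteq> v"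
  shows "pair_graph (add_edge G u v)"
proof -
  interpret pair_graph G by fact
  show ?thesis
    using assms(2-) wellformed' no_loops' arcs_symmetric pair_finite_verts pair_finite_arcs
    by unfold_locales (auto simp: add_edge_def symmetric_def sym_def)
qed

end

theory Submission
  imports Defs
begin

text \<open>
  Two distinct colourings \<open>P\<close>, \<open>Q\<close> of \<open>G\<close> give the matrix of the numbers
  \<open>card (P\<^sub>i \<inter> Q\<^sub>j)\<close>, and if \<open>G\<close> is maximal then it must be the graph of that matrix, whichever
  pair is chosen. So for a maximal \<open>G\<close> it suffices to find one pair whose matrix is desirable.
  If some colouring has fewer than \<open>k\<close> classes, splitting a class shows that \<open>G\<close> is complete
  multipartite, and the matrix is tiny or small. Otherwise the nonzero cells cannot be covered by
  fewer than \<open>k\<close> lines, so by Hall's theorem the diagonal may be taken nonzero; reading the matrix as a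
  digraph, an arc on no cycle leads to a special matrix and a nontrivial strong component to a
  normal one. Conversely, an independent set of the graph of a matrix lies in a row or in a column,
  and for special and normal matrices this leaves only the two defining colourings, one of
  which is destroyed by any new edge.
\<close>

section \<open>Colour functions\<close>

text \<open>Once row and column colours are matched along a nonzero diagonal, the vertices on it
  form a \<open>k\<close>-clique, and a vertex in cell \<open>(i, j)\<close> acts as an arc from
  \<open>i\<close> to \<open>j\<close>. A set \<open>C\<close> of colours that no arc leaves is the
  same as a zero block with rows \<open>C\<close> and columns outside \<open>C\<close>. It yields a
  third colouring: a vertex whose row is in \<open>C\<close> takes its column, any other vertex its
  row. This is how connectivity enters, and why full indecomposability, which for a nonzero diagonal
  is strong connectivity, describes normal matrices. Rather than refute undesirable matrices, the
  proof uses such third colourings to replace the pair at hand by a pair that differs only at a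
  single vertex or only inside a single strong component.\<close>

definition proper_col :: "nat \<Rightarrow> 'a pair_pre_digraph \<Rightarrow> ('a \<Rightarrow> nat) \<Rightarrow> bool" where
  "proper_col k G f \<longleftrightarrow> f ` pverts G \<subseteq> {..<k} \<and>
     (\<forall>u\<in>pverts G. \<forall>v\<in>pverts G. (u, v) \<in> parcs G \<longrightarrow> f u \<noteq> f v)"

lemma proper_colD:
  assumes "proper_col k G f"
  shows "v \<in> pverts G \<Longrightarrow> f v < k"
    and "u \<in> pverts G \<Longrightarrow> v \<in> pverts G \<Longrightarrow> (u, v) \<in> parcs G \<Longrightarrow> f u \<noteq> f v"
  using assms by (auto simp: proper_col_def)

lemma coloring_imp_proper_col:
  assumes P: "coloring k G P"
  shows "\<exists>f. proper_col k G f \<and>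
    (\<forall>u\<in>pverts G. \<forall>v\<in>pverts G. f u = f v \<longleftrightarrow> (\<exists>S\<in>P. u \<in> S \<and> v \<in> S))"
proof -
  have part: "partition_on (pverts G) P" and fin: "finite P" and card: "card P \<le> k"
    and anti: "\<And>S. S \<in> P \<Longrightarrow> anticlique G S"
    using P by (auto simp: coloring_def)
  obtain e where e: "inj_on e P" "e ` P \<subseteq> {..<k}"
    using card_le_inj[of P "{..<k}"] fin card by auto
  have uniq: "\<exists>!S. S \<in> P \<and> v \<in> S" if "v \<in> pverts G" for v
    using partition_onD1[OF part] disjointD[OF partition_onD2[OF part]] that by blast
  define cl where "cl v = (THE S. S \<in> P \<and> v \<in> S)" for v
  have cl: "cl v \<in> P" "v \<in> cl v" if "v \<in> pverts G" for v
    using theI'[OF uniq[OF that]] by (auto simp: cl_def)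
  have cl_eq: "S = cl v" if "v \<in> pverts G" "S \<in> P" "v \<in> S" for S v
    using the1_equality[OF uniq[OF that(1)], of S] that(2,3) by (simp add: cl_def)
  have ker: "e (cl u) = e (cl v) \<longleftrightarrow> (\<exists>S\<in>P. u \<in> S \<and> v \<in> S)"
    if "u \<in> pverts G" "v \<in> pverts G" for u v
  proof -
    have "e (cl u) = e (cl v) \<longleftrightarrow> cl u = cl v"
      using inj_on_eq_iff[OF e(1)] cl that by blast
    also have "\<dots> \<longleftrightarrow> (\<exists>S\<in>P. u \<in> S \<and> v \<in> S)"
      using cl that cl_eq by metis
    finally show ?thesis .
  qed
  have "e (cl v) < k" if "v \<in> pverts G" for v
    using e(2) cl(1)[OF that] by blast
  moreover have "e (cl u) \<noteq> e (cl v)" if "u \<in> pverts G" "v \<in> pverts G" "(u, v) \<in> parcs G" for u v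
    using ker[OF that(1,2)] anti that(3) unfolding anticlique_def by blast
  ultimately have "proper_col k G (\<lambda>v. e (cl v))"
    by (auto simp: proper_col_def)
  with ker show ?thesis by blast
qed

text \<open>Only the colours in use index the classes, since a partition has no empty class.\<close>

lemma proper_col_imp_coloring:
  assumes f: "proper_col k G f"
  shows "coloring k G ((\<lambda>i. {v \<in> pverts G. f v = i}) ` f ` pverts G)"
proof -
  have sub: "f ` pverts G \<subseteq> {..<k}"
    using f by (auto simp: proper_col_def)
  then have fin: "finite (f ` pverts G)" and "card (f ` pverts G) \<le> k"
    using finite_subset card_mono[OF _ sub] by auto
  moreover have "partition_on (pverts G) ((\<lambda>i. {v \<in> pverts G. f v = i}) ` f ` pverts G)"
    by (rule partition_onI) (auto simp: disjnt_def)
  moreover have "anticlique G {v \<in> pverts G. f v = i}" for i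
    using proper_colD(2)[OF f] unfolding anticlique_def by blast
  ultimately show ?thesis
    using card_image_le[OF fin, of "\<lambda>i. {v \<in> pverts G. f v = i}"]
    by (auto simp: coloring_def)
qed

text \<open>A partition is determined by its equivalence relation, so of two distinct colourings one
  joins a pair of vertices that the other separates. Exchanging the colourings if necessary,
  \<open>f\<close> is the one that joins.\<close>

lemma ambiguously_colorable_iff:
  "ambiguously_colorable k G \<longleftrightarrow>
    (\<exists>f g. proper_col k G f \<and> proper_col k G g \<and>
      (\<exists>u\<in>pverts G. \<exists>v\<in>pverts G. f u = f v \<and> g u \<noteq> g v))"
proof
  assume "ambiguously_colorable k G"
  then obtain P Q where PQ: "coloring k G P" "coloring k G Q" "P \<noteq> Q"
    by (auto simp: ambiguously_colorable_def)
  obtain f where f: "proper_col k G f"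
    "\<And>u v. u \<in> pverts G \<Longrightarrow> v \<in> pverts G \<Longrightarrow> f u = f v \<longleftrightarrow> (\<exists>S\<in>P. u \<in> S \<and> v \<in> S)"
    using coloring_imp_proper_col[OF PQ(1)] by blast
  obtain g where g: "proper_col k G g"
    "\<And>u v. u \<in> pverts G \<Longrightarrow> v \<in> pverts G \<Longrightarrow> g u = g v \<longleftrightarrow> (\<exists>S\<in>Q. u \<in> S \<and> v \<in> S)"
    using coloring_imp_proper_col[OF PQ(2)] by blast
  have part: "partition_on (pverts G) P" "partition_on (pverts G) Q"
    using PQ by (auto simp: coloring_def)
  then have "\<Union> P = pverts G" "\<Union> Q = pverts G"
    by (auto simp: partition_on_def)
  have "\<exists>u\<in>pverts G. \<exists>v\<in>pverts G. (f u = f v) \<noteq> (g u = g v)"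
  proof (rule ccontr)
    assume "\<not> ?thesis"
    then have "(\<exists>S\<in>P. u \<in> S \<and> v \<in> S) = (\<exists>S\<in>Q. u \<in> S \<and> v \<in> S)"
      if "u \<in> pverts G" "v \<in> pverts G" for u v
      using f(2)[OF that] g(2)[OF that] that by blast
    moreover have "u \<in> pverts G \<and> v \<in> pverts G" if "S \<in> P \<union> Q" "u \<in> S" "v \<in> S" for S u v
      using that \<open>\<Union> P = pverts G\<close> \<open>\<Union> Q = pverts G\<close> by blast
    ultimately have "(\<exists>S\<in>P. u \<in> S \<and> v \<in> S) = (\<exists>S\<in>Q. u \<in> S \<and> v \<in> S)" for u v
      by (cases "u \<in> pverts G \<and> v \<in> pverts G") (blast, meson UnCI)
    then have "{(x, y). \<exists>p\<in>P. x \<in> p \<and> y \<in> p} = {(x, y). \<exists>p\<in>Q. x \<in> p \<and> y \<in> p}"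
      by simp
    then show False
      using partition_on_eq_quotient[OF part(1)] partition_on_eq_quotient[OF part(2)] PQ(3)
      by simp
  qed
  then show "\<exists>f g. proper_col k G f \<and> proper_col k G g \<and>
      (\<exists>u\<in>pverts G. \<exists>v\<in>pverts G. f u = f v \<and> g u \<noteq> g v)"
    using f(1) g(1) by blast
next
  assume "\<exists>f g. proper_col k G f \<and> proper_col k G g \<and>
      (\<exists>u\<in>pverts G. \<exists>v\<in>pverts G. f u = f v \<and> g u \<noteq> g v)"
  then obtain f g u v where fg: "proper_col k G f" "proper_col k G g"
    and uv: "u \<in> pverts G" "v \<in> pverts G" "f u = f v" "g u \<noteq> g v"
    by blast
  let ?C = "\<lambda>h. (\<lambda>i. {v \<in> pverts G. h v = i}) ` h ` pverts G"
  have "{x \<in> pverts G. f x = f u} \<in> ?C f"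
    using uv by blast
  moreover have "{x \<in> pverts G. f x = f u} \<notin> ?C g"
  proof
    assume "{x \<in> pverts G. f x = f u} \<in> ?C g"
    then obtain i where i: "{x \<in> pverts G. f x = f u} = {x \<in> pverts G. g x = i}"
      by auto
    have "u \<in> {x \<in> pverts G. f x = f u}" "v \<in> {x \<in> pverts G. f x = f u}"
      using uv by auto
    then show False
      unfolding i using uv(4) by simp
  qed
  ultimately show "ambiguously_colorable k G"
    using proper_col_imp_coloring[OF fg(1)] proper_col_imp_coloring[OF fg(2)]
    unfolding ambiguously_colorable_def by (intro exI[of _ "?C f"] exI[of _ "?C g"]) auto
qed

lemma proper_col_add_edge:
  assumes "u \<in> pverts G" "v \<in> pverts G"
  shows "proper_col k (add_edge G u v) f \<longleftrightarrow> proper_col k G f \<and> f u \<noteq> f v"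
proof -
  have "(\<forall>x\<in>pverts G. \<forall>y\<in>pverts G. (x, y) \<in> parcs G \<union> {(u, v), (v, u)} \<longrightarrow> f x \<noteq> f y) \<longleftrightarrow>
    (\<forall>x\<in>pverts G. \<forall>y\<in>pverts G. (x, y) \<in> parcs G \<longrightarrow> f x \<noteq> f y) \<and> f u \<noteq> f v"
    using assms by fastforce
  then show ?thesis
    by (simp add: proper_col_def add_edge_def)
qed

lemma pverts_add_edge [simp]: "pverts (add_edge G u v) = pverts G"
  by (simp add: add_edge_def)

lemma ambiguously_colorable_add_edge_iff:
  assumes "u \<in> pverts G" "v \<in> pverts G"
  shows "ambiguously_colorable k (add_edge G u v) \<longleftrightarrow>
    (\<exists>f g. proper_col k G f \<and> proper_col k G g \<and> f u \<noteq> f v \<and> g u \<noteq> g v \<and>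
      (\<exists>x\<in>pverts G. \<exists>y\<in>pverts G. f x = f y \<and> g x \<noteq> g y))"
  unfolding ambiguously_colorable_iff proper_col_add_edge[OF assms] pverts_add_edge by blast

text \<open>If both colourings separate \<open>u\<close> and \<open>v\<close>, both survive the edge
  \<open>uv\<close>, and \<open>x\<close>, \<open>y\<close> still witness that they differ; by
  maximality the edge was already there. So any two distinct colourings determine the adjacency of a
  maximal graph.\<close>

lemma maximal_imp_parcs_iff:
  assumes "maximal_ambiguously_colorable k G"
    and "proper_col k G f" "proper_col k G g"
    and "x \<in> pverts G" "y \<in> pverts G" "f x = f y" "g x \<noteq> g y"
    and "u \<in> pverts G" "v \<in> pverts G"
  shows "(u, v) \<in> parcs G \<longleftrightarrow> f u \<noteq> f v \<and> g u \<noteq> g v"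
proof
  assume sep: "f u \<noteq> f v \<and> g u \<noteq> g v"
  have "ambiguously_colorable k (add_edge G u v)"
    unfolding ambiguously_colorable_add_edge_iff[OF assms(8,9)]
    by (rule exI[of _ f], rule exI[of _ g]) (use sep assms(2-7) in auto)
  moreover have "u \<noteq> v"
    using sep by blast
  ultimately show "(u, v) \<in> parcs G"
    using assms(1,8,9) unfolding maximal_ambiguously_colorable_def by blast
next
  assume "(u, v) \<in> parcs G"
  then show "f u \<noteq> f v \<and> g u \<noteq> g v"
    using proper_colD(2)[OF assms(2,8,9)] proper_colD(2)[OF assms(3,8,9)] by blast
qed

section \<open>Matrix representations\<close>

text \<open>This encodes an isomorphism onto \<open>mat_graph A\<close> by its first two coordinates
  only. The third one merely counts the vertices of a cell, so prescribing the cell sizes replaces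
  it.\<close>

definition represents ::
  "nat mat \<Rightarrow> 'a pair_pre_digraph \<Rightarrow> ('a \<Rightarrow> nat) \<Rightarrow> ('a \<Rightarrow> nat) \<Rightarrow> bool" where
  "represents A G f g \<longleftrightarrow>
     (\<forall>v\<in>pverts G. f v < dim_row A \<and> g v < dim_col A) \<and>
     (\<forall>i<dim_row A. \<forall>j<dim_col A. A $$ (i, j) = card {v \<in> pverts G. f v = i \<and> g v = j}) \<and>
     (\<forall>u\<in>pverts G. \<forall>v\<in>pverts G. (u, v) \<in> parcs G \<longleftrightarrow> f u \<noteq> f v \<and> g u \<noteq> g v)"

lemma representsD:
  assumes "represents A G f g"
  shows "v \<in> pverts G \<Longrightarrow> f v < dim_row A \<and> g v < dim_col A"
    and "i < dim_row A \<Longrightarrow> j < dim_col A \<Longrightarrow>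
      A $$ (i, j) = card {v \<in> pverts G. f v = i \<and> g v = j}"
    and "u \<in> pverts G \<Longrightarrow> v \<in> pverts G \<Longrightarrow> (u, v) \<in> parcs G \<longleftrightarrow> f u \<noteq> f v \<and> g u \<noteq> g v"
  using assms by (auto simp: represents_def)

text \<open>An isomorphism of digraphs also maps arcs, tails and heads. When arcs are ordered pairs
  of vertices, all of these are forced by the vertex map.\<close>

lemma digraph_iso_with_proj_iff:
  assumes "pair_wf_digraph G" "pair_wf_digraph H"
  shows "digraph_iso (with_proj G) (with_proj H) \<longleftrightarrow>
    (\<exists>h. bij_betw h (pverts G) (pverts H) \<and>
      (\<forall>u\<in>pverts G. \<forall>v\<in>pverts G. (u, v) \<in> parcs G \<longleftrightarrow> (h u, h v) \<in> parcs H))"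
proof
  interpret G: pair_wf_digraph G by fact
  assume "digraph_iso (with_proj G) (with_proj H)"
  then obtain hom where hom: "G.digraph_isomorphism hom"
    and H: "with_proj H = app_iso hom (with_proj G)"
    unfolding digraph_iso_def by blast
  let ?h = "iso_verts hom"
  have verts: "pverts H = ?h ` pverts G" and arcs: "parcs H = iso_arcs hom ` parcs G"
    and tail: "iso_tail hom = fst" and head: "iso_head hom = snd"
    using H by (auto simp: with_proj_def app_iso_def)
  have inj: "inj_on ?h (pverts G)"
    and ends: "\<And>a. a \<in> parcs G \<Longrightarrow> iso_arcs hom a = (?h (fst a), ?h (snd a))"
    using hom tail head by (auto simp: G.digraph_isomorphism_def prod_eq_iff)
  have "(u, v) \<in> parcs G \<longleftrightarrow> (?h u, ?h v) \<in> parcs H"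
    if "u \<in> pverts G" "v \<in> pverts G" for u v
  proof
    show "(u, v) \<in> parcs G \<Longrightarrow> (?h u, ?h v) \<in> parcs H"
      unfolding arcs using ends by force
    assume "(?h u, ?h v) \<in> parcs H"
    then obtain a where a: "a \<in> parcs G" "?h u = ?h (fst a)" "?h v = ?h (snd a)"
      unfolding arcs using ends by force
    moreover have "fst a \<in> pverts G" "snd a \<in> pverts G"
      using a(1) G.wellformed by auto
    ultimately have "u = fst a" "v = snd a"
      using inj that by (auto dest: inj_onD)
    then show "(u, v) \<in> parcs G"
      using a by simp
  qed
  then show "\<exists>h. bij_betw h (pverts G) (pverts H) \<and>
      (\<forall>u\<in>pverts G. \<forall>v\<in>pverts G. (u, v) \<in> parcs G \<longleftrightarrow> (h u, h v) \<in> parcs H)"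
    using inj verts by (auto simp: bij_betw_def)
next
  interpret G: pair_wf_digraph G by fact
  interpret H: pair_wf_digraph H by fact
  assume "\<exists>h. bij_betw h (pverts G) (pverts H) \<and>
      (\<forall>u\<in>pverts G. \<forall>v\<in>pverts G. (u, v) \<in> parcs G \<longleftrightarrow> (h u, h v) \<in> parcs H)"
  then obtain h where inj: "inj_on h (pverts G)" and verts: "pverts H = h ` pverts G"
    and arcs: "\<And>u v. u \<in> pverts G \<Longrightarrow> v \<in> pverts G \<Longrightarrow> (u, v) \<in> parcs G \<longleftrightarrow> (h u, h v) \<in> parcs H"
    by (auto simp: bij_betw_def)
  let ?hom = "\<lparr>iso_verts = h, iso_arcs = map_prod h h, iso_head = snd, iso_tail = fst\<rparr>"
  have "inj_on (map_prod h h) (parcs G)"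
    using inj map_prod_inj_on[OF inj inj] by (rule_tac inj_on_subset) (auto dest: G.in_arcsD1 G.in_arcsD2 G.wellformed)
  then have "G.digraph_isomorphism ?hom"
    using inj by (auto simp: G.digraph_isomorphism_def G.wf_digraph)
  moreover have "parcs H = map_prod h h ` parcs G"
  proof
    show "parcs H \<subseteq> map_prod h h ` parcs G"
    proof
      fix a assume a: "a \<in> parcs H"
      then have "fst a \<in> h ` pverts G" "snd a \<in> h ` pverts G"
        using H.wellformed verts by blast+
      then obtain u v where "u \<in> pverts G" "v \<in> pverts G" "a = (h u, h v)"
        by (metis imageE prod.collapse)
      with a arcs show "a \<in> map_prod h h ` parcs G"
        by (force intro: image_eqI[of _ _ "(u, v)"])
    qed
    show "map_prod h h ` parcs G \<subseteq> parcs H"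
    proof
      fix a assume "a \<in> map_prod h h ` parcs G"
      then obtain u v where "(u, v) \<in> parcs G" "a = (h u, h v)"
        by auto
      then show "a \<in> parcs H"
        using arcs G.wellformed by fastforce
    qed
  qed
  ultimately show "digraph_iso (with_proj G) (with_proj H)"
    unfolding digraph_iso_def
    by (intro exI[of _ ?hom]) (auto simp: app_iso_def with_proj_def verts)
qed

lemma parcs_mat_graph_iff:
  "(a, b) \<in> parcs (mat_graph A) \<longleftrightarrow> a \<in> mat_graph_verts A \<and> b \<in> mat_graph_verts A \<and>
    fst a \<noteq> fst b \<and> fst (snd a) \<noteq> fst (snd b)"
  by (cases a; cases b) (simp add: mat_graph_def)

lemma digraph_iso_mat_graph_iff:
  assumes "pair_graph G"
  shows "digraph_iso (with_proj G) (with_proj (mat_graph A)) \<longleftrightarrow> (\<exists>f g. represents A G f g)"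
proof -
  interpret pair_graph G by fact
  interpret M: pair_graph "mat_graph A" by (rule pair_graph_mat_graph)
  let ?V = "mat_graph_verts A"
  have pverts: "pverts (mat_graph A) = ?V"
    by (simp add: mat_graph_def)
  have "digraph_iso (with_proj G) (with_proj (mat_graph A)) \<longleftrightarrow>
    (\<exists>h. bij_betw h (pverts G) ?V \<and>
      (\<forall>u\<in>pverts G. \<forall>v\<in>pverts G. (u, v) \<in> parcs G \<longleftrightarrow> (h u, h v) \<in> parcs (mat_graph A)))"
    using digraph_iso_with_proj_iff[OF pair_wf_digraph M.pair_wf_digraph]
    unfolding pverts .
  also have "\<dots> \<longleftrightarrow> (\<exists>f g. represents A G f g)"
  proof
    assume "\<exists>h. bij_betw h (pverts G) ?V \<and>
      (\<forall>u\<in>pverts G. \<forall>v\<in>pverts G. (u, v) \<in> parcs G \<longleftrightarrow> (h u, h v) \<in> parcs (mat_graph A))"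
    then obtain h where h: "bij_betw h (pverts G) ?V"
      and arcs: "\<And>u v. u \<in> pverts G \<Longrightarrow> v \<in> pverts G \<Longrightarrow>
        (u, v) \<in> parcs G \<longleftrightarrow> (h u, h v) \<in> parcs (mat_graph A)"
      by blast
    define f where "f = fst \<circ> h"
    define g where "g = fst \<circ> snd \<circ> h"
    have inV: "h v \<in> ?V" if "v \<in> pverts G" for v
      using bij_betwE[OF h] that by blast
    have "A $$ (i, j) = card {v \<in> pverts G. f v = i \<and> g v = j}"
      if "i < dim_row A" "j < dim_col A" for i j
    proof -
      have "h ` {v \<in> pverts G. f v = i \<and> g v = j} = {w \<in> ?V. fst w = i \<and> fst (snd w) = j}"
        unfolding bij_betw_imp_surj_on[OF h, symmetric] by (auto simp: f_def g_def)
      also have "\<dots> = (\<lambda>t. (i, j, t)) ` {1..A $$ (i, j)}"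
        using that by (auto simp: mat_graph_verts_def)
      finally have "card (h ` {v \<in> pverts G. f v = i \<and> g v = j}) = A $$ (i, j)"
        by (simp add: card_image inj_on_def)
      moreover have "inj_on h {v \<in> pverts G. f v = i \<and> g v = j}"
        using bij_betw_imp_inj_on[OF h] by (rule inj_on_subset) auto
      ultimately show ?thesis
        by (simp add: card_image)
    qed
    moreover have "f v < dim_row A \<and> g v < dim_col A" if "v \<in> pverts G" for v
      using inV[OF that] by (auto simp: f_def g_def mat_graph_verts_def)
    moreover have "(u, v) \<in> parcs G \<longleftrightarrow> f u \<noteq> f v \<and> g u \<noteq> g v"
      if "u \<in> pverts G" "v \<in> pverts G" for u v
      using arcs[OF that] inV[OF that(1)] inV[OF that(2)]
      by (simp add: parcs_mat_graph_iff f_def g_def)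
    ultimately have "represents A G f g"
      by (simp add: represents_def)
    then show "\<exists>f g. represents A G f g"
      by blast
  next
    assume "\<exists>f g. represents A G f g"
    then obtain f g where fg: "represents A G f g"
      by blast
    have lt: "\<And>v. v \<in> pverts G \<Longrightarrow> f v < dim_row A \<and> g v < dim_col A"
      and card: "\<And>i j. i < dim_row A \<Longrightarrow> j < dim_col A \<Longrightarrow>
        A $$ (i, j) = card {v \<in> pverts G. f v = i \<and> g v = j}"
      and arcs: "\<And>u v. u \<in> pverts G \<Longrightarrow> v \<in> pverts G \<Longrightarrow>
        (u, v) \<in> parcs G \<longleftrightarrow> f u \<noteq> f v \<and> g u \<noteq> g v"
      by (rule representsD[OF fg]; assumption)+
    let ?F = "\<lambda>i j. {v \<in> pverts G. f v = i \<and> g v = j}"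
    \<comment> \<open>Vertices of one cell are nonadjacent twins, so an arbitrary numbering of each
      cell can serve as third coordinate.\<close>
    define e where "e i j = (SOME e. bij_betw e (?F i j) {1..card (?F i j)})" for i j
    have e: "bij_betw (e i j) (?F i j) {1..card (?F i j)}" for i j
      unfolding e_def
      by (rule someI_ex[OF finite_same_card_bij]) (use pair_finite_verts in simp_all)
    define h where "h v = (f v, g v, e (f v) (g v) v)" for v
    have inV: "h v \<in> ?V" if "v \<in> pverts G" for v
    proof -
      have "e (f v) (g v) v \<in> {1..card (?F (f v) (g v))}"
        using bij_betwE[OF e[of "f v" "g v"]] that by blast
      then show ?thesis
        using lt[OF that] card[of "f v" "g v"] by (simp add: h_def mat_graph_verts_def)
    qed
    have "bij_betw h (pverts G) ?V"
    proof (rule bij_betw_imageI)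
      show "inj_on h (pverts G)"
      proof (rule inj_onI)
        fix u v assume "u \<in> pverts G" "v \<in> pverts G" "h u = h v"
        then have eq: "f u = f v" "g u = g v" "e (f u) (g u) u = e (f v) (g v) v"
          unfolding h_def prod.inject by blast+
        have "u \<in> ?F (f u) (g u)" "v \<in> ?F (f u) (g u)"
          using \<open>u \<in> pverts G\<close> \<open>v \<in> pverts G\<close> eq by simp_all
        moreover have "e (f u) (g u) u = e (f u) (g u) v"
          using eq by simp
        ultimately show "u = v"
          using inj_onD[OF bij_betw_imp_inj_on[OF e]] by blast
      qed
      have "?V \<subseteq> h ` pverts G"
      proof
        fix w assume "w \<in> ?V"
        then obtain i j t where w: "w = (i, j, t)" "i < dim_row A" "j < dim_col A"
          "t \<in> {1..A $$ (i, j)}"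
          unfolding mat_graph_verts_def by blast
        have "t \<in> e i j ` ?F i j"
          using w(4) card[OF w(2,3)] bij_betw_imp_surj_on[OF e[of i j]] by simp
        then obtain v where v: "v \<in> ?F i j" "e i j v = t"
          by (elim imageE) simp
        then have "w = h v"
          using w(1) by (simp add: h_def)
        with v(1) show "w \<in> h ` pverts G"
          by simp
      qed
      then show "h ` pverts G = ?V"
        using inV by blast
    qed
    moreover have "(u, v) \<in> parcs G \<longleftrightarrow> (h u, h v) \<in> parcs (mat_graph A)"
      if "u \<in> pverts G" "v \<in> pverts G" for u v
      using arcs[OF that] inV[OF that(1)] inV[OF that(2)]
      by (simp add: parcs_mat_graph_iff h_def)
    ultimately show "\<exists>h. bij_betw h (pverts G) ?V \<and>
      (\<forall>u\<in>pverts G. \<forall>v\<in>pverts G. (u, v) \<in> parcs G \<longleftrightarrow> (h u, h v) \<in> parcs (mat_graph A))"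
      by blast
  qed
  finally show ?thesis .
qed

lemma represents_imp_proper_col:
  assumes "represents A G f g" "A \<in> carrier_mat k k"
  shows "proper_col k G f" "proper_col k G g"
  using assms by (auto simp: represents_def proper_col_def)

lemma represents_nonzero_iff:
  assumes rep: "represents A G f g" and A: "A \<in> carrier_mat k k" and fin: "finite (pverts G)"
    and ij: "i < k" "j < k"
  shows "A $$ (i, j) \<noteq> 0 \<longleftrightarrow> (\<exists>v\<in>pverts G. f v = i \<and> g v = j)"
proof -
  have "A $$ (i, j) = card {v \<in> pverts G. f v = i \<and> g v = j}"
    using representsD(2)[OF rep] A ij by auto
  then show ?thesis
    using fin by auto
qed

lemma represents_transversal:
  assumes rep: "represents A G f g" and A: "A \<in> carrier_mat k k" and fin: "finite (pverts G)"
    and diag: "\<And>i. i < k \<Longrightarrow> A $$ (i, i) \<noteq> 0"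
  shows "\<exists>r. \<forall>i<k. r i \<in> pverts G \<and> f (r i) = i \<and> g (r i) = i"
proof -
  have "\<forall>i\<in>{..<k}. \<exists>v. v \<in> pverts G \<and> f v = i \<and> g v = i"
  proof
    fix i assume "i \<in> {..<k}"
    then have "i < k" by simp
    then show "\<exists>v. v \<in> pverts G \<and> f v = i \<and> g v = i"
      using represents_nonzero_iff[OF rep A fin, of i i] diag by blast
  qed
  from bchoice[OF this] show ?thesis
    by auto
qed

text \<open>The last clause is strong connectivity of the digraph of nonzero cells on
  \<open>{..<r}\<close>: every nonempty proper subset has an arc leaving it. Everything is stated
  for \<open>A\<close> itself, so that no blocks have to be carried along.\<close>

definition normal_form :: "nat mat \<Rightarrow> nat \<Rightarrow> nat \<Rightarrow> bool" where
  "normal_form A k r \<longleftrightarrow> 2 \<le> r \<and> r \<le> k \<and> (\<forall>i<k. A $$ (i, i) \<noteq> 0) \<and>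
    (\<forall>i<k. \<forall>j<k. i \<noteq> j \<longrightarrow> A $$ (i, j) \<noteq> 0 \<longrightarrow> i < r \<and> j < r) \<and>
    (\<forall>I. I \<subseteq> {..<r} \<longrightarrow> I \<noteq> {} \<longrightarrow> I \<noteq> {..<r} \<longrightarrow> (\<exists>i\<in>I. \<exists>j\<in>{..<r} - I. A $$ (i, j) \<noteq> 0))"

lemma normal_formD:
  assumes "normal_form A k r"
  shows "2 \<le> r" "r \<le> k" "i < k \<Longrightarrow> A $$ (i, i) \<noteq> 0"
    and "i < k \<Longrightarrow> j < k \<Longrightarrow> i \<noteq> j \<Longrightarrow> A $$ (i, j) \<noteq> 0 \<Longrightarrow> i < r \<and> j < r"
    and "I \<subseteq> {..<r} \<Longrightarrow> I \<noteq> {} \<Longrightarrow> I \<noteq> {..<r} \<Longrightarrow> \<exists>i\<in>I. \<exists>j\<in>{..<r} - I. A $$ (i, j) \<noteq> 0"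
  using assms unfolding normal_form_def by (simp_all only: simp_thms)

lemma normal_formI:
  assumes "\<And>i. i < k \<Longrightarrow> A $$ (i, i) \<noteq> 0"
    and "\<And>i j. i < k \<Longrightarrow> j < k \<Longrightarrow> i \<noteq> j \<Longrightarrow> A $$ (i, j) \<noteq> 0 \<Longrightarrow> i < r \<and> j < r"
    and "\<And>I. I \<subseteq> {..<r} \<Longrightarrow> I \<noteq> {} \<Longrightarrow> I \<noteq> {..<r} \<Longrightarrow>
      \<exists>i\<in>I. \<exists>j\<in>{..<r} - I. A $$ (i, j) \<noteq> 0"
    and "r \<le> k" "2 \<le> r"
  shows "normal_form A k r"
  unfolding normal_form_def using assms by (intro conjI allI impI) simp_all

text \<open>A zero submatrix of \<open>M\<close> avoids the nonzero diagonal, so its row set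
  \<open>I\<close> and its column set \<open>J\<close> are disjoint. As their sizes add up to
  \<open>r\<close>, \<open>J\<close> is the complement of \<open>I\<close>, and full
  indecomposability turns into strong connectivity.\<close>

lemma normal_iff:
  assumes A: "A \<in> carrier_mat k k"
  shows "normal A \<longleftrightarrow> (\<exists>r. normal_form A k r)"
proof
  assume "normal A"
  then obtain r s M D where M: "M \<in> carrier_mat r r" and D: "D \<in> carrier_mat s s"
    and AMD: "A = four_block_mat M (0\<^sub>m r s) (0\<^sub>m s r) D"
    and D_diag: "diagonal_mat D" and D_nz: "\<And>i. i < s \<Longrightarrow> D $$ (i, i) \<noteq> 0"
    and M_nz: "\<And>i. i < r \<Longrightarrow> M $$ (i, i) \<noteq> 0" and r: "r \<ge> 2" and M_ind: "fully_indecomposable M"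
    unfolding normal_def by blast
  have k: "k = r + s"
    using A M D unfolding AMD by auto
  have entry: "A $$ (i, j) = (if i < r then if j < r then M $$ (i, j) else 0
      else if j < r then 0 else D $$ (i - r, j - r))" if "i < k" "j < k" for i j
    using that M D unfolding AMD k by auto
  have "A $$ (i, i) \<noteq> 0" if "i < k" for i
    using entry[OF that that] M_nz D_nz[of "i - r"] that k by auto
  moreover have "i < r \<and> j < r" if "i < k" "j < k" "i \<noteq> j" "A $$ (i, j) \<noteq> 0" for i j
  proof (rule ccontr)
    assume "\<not> (i < r \<and> j < r)"
    then have "\<not> i < r" "\<not> j < r" "D $$ (i - r, j - r) \<noteq> 0"
      using entry[OF that(1,2)] that(4) by (auto split: if_splits)
    then show False
      using D_diag D that(1-3) k by (auto simp: diagonal_mat_def)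
  qed
  moreover have "\<exists>i\<in>I. \<exists>j\<in>{..<r} - I. A $$ (i, j) \<noteq> 0"
    if I: "I \<subseteq> {..<r}" "I \<noteq> {}" "I \<noteq> {..<r}" for I
  proof (rule ccontr)
    assume *: "\<not> ?thesis"
    have "M $$ (i, j) = 0" if "i \<in> I" "j \<in> {..<r} - I" for i j
      using * that I(1) entry[of i j] k by auto
    moreover have "finite I"
      using I(1) finite_subset by blast
    moreover from this have "card ({..<r} - I) = r - card I"
      using I(1) by (simp add: card_Diff_subset)
    ultimately have "has_zero_submatrix M (card I) (r - card I)"
      using I(1) M unfolding has_zero_submatrix_def
      by (intro exI[of _ I] exI[of _ "{..<r} - I"]) auto
    moreover have "card I < r"
      using psubset_card_mono[of "{..<r}" I] I by auto
    moreover have "card I > 0"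
      using I \<open>finite I\<close> by (simp add: card_gt_0_iff)
    ultimately show False
      using M_ind M by (auto simp: fully_indecomposable_def)
  qed
  moreover have "r \<le> k"
    using k by simp
  ultimately have "normal_form A k r"
    using r by (intro normal_formI)
  then show "\<exists>r. normal_form A k r" ..
next
  assume "\<exists>r. normal_form A k r"
  then obtain r where P: "normal_form A k r" ..
  note r = normal_formD(1,2)[OF P] and nz = normal_formD(3)[OF P]
    and off = normal_formD(4)[OF P] and irr = normal_formD(5)[OF P]
  define s where "s = k - r"
  define M where "M = mat r r (\<lambda>ij. A $$ ij)"
  define D where "D = mat s s (\<lambda>(i, j). A $$ (i + r, j + r))"
  have k: "k = r + s"
    using r by (simp add: s_def)
  have zero: "A $$ (i, j) = 0" if "i < k" "j < k" "i \<noteq> j" "\<not> (i < r \<and> j < r)" for i j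
    using off that by blast
  have AMD: "A = four_block_mat M (0\<^sub>m r s) (0\<^sub>m s r) D"
  proof (rule eq_matI)
    fix i j
    assume "i < dim_row (four_block_mat M (0\<^sub>m r s) (0\<^sub>m s r) D)"
      "j < dim_col (four_block_mat M (0\<^sub>m r s) (0\<^sub>m s r) D)"
    then have ij: "i < r + s" "j < r + s"
      by (auto simp: M_def D_def)
    then show "A $$ (i, j) = four_block_mat M (0\<^sub>m r s) (0\<^sub>m s r) D $$ (i, j)"
      using zero[of i j] k by (auto simp: M_def D_def)
  qed (use A k in \<open>auto simp: M_def D_def\<close>)
  have "fully_indecomposable M"
  proof (rule ccontr)
    assume "\<not> ?thesis"
    then obtain p I J where p: "p \<in> {1..r - 1}" and IJ: "I \<subseteq> {..<r}" "J \<subseteq> {..<r}"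
      "card I = p" "card J = r - p" and M0: "\<And>i j. i \<in> I \<Longrightarrow> j \<in> J \<Longrightarrow> M $$ (i, j) = 0"
      by (auto simp: fully_indecomposable_def has_zero_submatrix_def M_def)
    then have IJ0: "A $$ (i, j) = 0" if "i \<in> I" "j \<in> J" for i j
    proof -
      have "i < r" "j < r" "M $$ (i, j) = 0"
        using that IJ(1,2) M0 by auto
      then show ?thesis
        by (simp add: M_def)
    qed
    have "finite I"
      using IJ(1) finite_subset by blast
    have "I \<inter> J = {}"
    proof (rule equals0I)
      fix i assume "i \<in> I \<inter> J"
      then show False
        using IJ0[of i i] nz[of i] IJ(1) k by auto
    qed
    then have "J \<subseteq> {..<r} - I"
      using IJ(2) by blast
    moreover have "card ({..<r} - I) = card J"
      using IJ \<open>finite I\<close> by (simp add: card_Diff_subset)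
    ultimately have "J = {..<r} - I"
      by (intro card_seteq) auto
    moreover have "I \<noteq> {}" "I \<noteq> {..<r}"
      using IJ(3) p by auto
    ultimately obtain i j where "i \<in> I" "j \<in> J" "A $$ (i, j) \<noteq> 0"
      using irr[OF IJ(1)] by auto
    then show False
      using IJ0 by simp
  qed
  moreover have "diagonal_mat D"
    using zero k by (auto simp: diagonal_mat_def D_def)
  moreover have "\<forall>i<s. D $$ (i, i) \<noteq> 0" "\<forall>i<r. M $$ (i, i) \<noteq> 0"
    using nz k by (auto simp: M_def D_def)
  moreover have "M \<in> carrier_mat r r" "D \<in> carrier_mat s s"
    by (simp_all add: M_def D_def)
  ultimately show "normal A"
    unfolding normal_def using AMD r(1)
    by (intro exI[of _ r] exI[of _ s] exI[of _ M] exI[of _ D] conjI) assumption+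
qed

section \<open>Desirable matrices give maximal graphs\<close>

text \<open>A transversal of vertices on the diagonal is a \<open>k\<close>-clique, so each colour class contains
  exactly one of its vertices; a vertex in cell \<open>(i, j)\<close> can only join the class of the
  \<open>i\<close>-th or the \<open>j\<close>-th one.\<close>

lemma coloring_from_transversal:
  fixes k :: nat and f g h :: "'a \<Rightarrow> nat"
  assumes r: "\<And>i. i < k \<Longrightarrow> r i \<in> V \<and> f (r i) = i \<and> g (r i) = i"
    and h: "h ` V \<subseteq> {..<k}"
    and sep: "\<And>u v. u \<in> V \<Longrightarrow> v \<in> V \<Longrightarrow> f u \<noteq> f v \<Longrightarrow> g u \<noteq> g v \<Longrightarrow> h u \<noteq> h v"
  shows "\<exists>s. (\<forall>v\<in>V. s v = f v \<or> s v = g v) \<and> (\<forall>u\<in>V. \<forall>v\<in>V. h u = h v \<longleftrightarrow> s u = s v)"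
proof -
  have rV: "r i \<in> V" and fr: "f (r i) = i" and gr: "g (r i) = i" if "i < k" for i
    using r[OF that] by simp_all
  have hr_ne: "h (r i) \<noteq> h (r j)" if "i < k" "j < k" "i \<noteq> j" for i j
    by (rule sep) (simp_all add: rV fr gr that)
  then have inj: "inj_on (\<lambda>i. h (r i)) {..<k}"
    by (intro inj_onI) (metis lessThan_iff)
  have "(\<lambda>i. h (r i)) ` {..<k} \<subseteq> {..<k}"
    using h rV by (intro image_subsetI) blast
  then have surj: "(\<lambda>i. h (r i)) ` {..<k} = {..<k}"
    by (intro endo_inj_surj inj) simp_all
  \<comment> \<open>\<open>s\<close> is \<open>h\<close> with its colours renamed so that the
    transversal vertex \<open>r i\<close> gets colour \<open>i\<close>. This is possible because the
    clique uses up all \<open>k\<close> colours.\<close>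
  define s where "s v = (SOME i. i < k \<and> h v = h (r i))" for v
  have s: "s v < k \<and> h v = h (r (s v))" if "v \<in> V" for v
  proof -
    have "h v \<in> (\<lambda>i. h (r i)) ` {..<k}"
      unfolding surj using h that by blast
    then have "\<exists>i. i < k \<and> h v = h (r i)"
      by (elim imageE) (simp, blast)
    then show ?thesis
      unfolding s_def by (rule someI_ex)
  qed
  have "s v = f v \<or> s v = g v" if "v \<in> V" for v
  proof (rule ccontr)
    assume ne: "\<not> ?thesis"
    have "h v \<noteq> h (r (s v))"
      by (rule sep) (use s[OF that] ne that in \<open>auto simp: rV fr gr\<close>)
    then show False
      using s[OF that] by simp
  qed
  moreover have "h u = h v \<longleftrightarrow> s u = s v" if "u \<in> V" "v \<in> V" for u v
  proof
    assume "h u = h v"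
    then show "s u = s v"
      using s[OF that(1)] s[OF that(2)] hr_ne[of "s u" "s v"] by argo
  next
    assume "s u = s v"
    then show "h u = h v"
      using s[OF that(1)] s[OF that(2)] by simp
  qed
  ultimately show ?thesis
    by (intro exI[of _ s]) simp
qed

section \<open>Graphs with exactly two colourings: special and normal matrices\<close>

lemma ambiguously_colorableI:
  assumes "proper_col k G f" "proper_col k G g"
    and "x \<in> pverts G" "y \<in> pverts G" "f x = f y" "g x \<noteq> g y"
  shows "ambiguously_colorable k G"
  unfolding ambiguously_colorable_iff using assms by blast

text \<open>By \<open>arcs\<close>, a nonadjacent pair is joined by \<open>f\<close> or by
  \<open>g\<close>. An edge between its members destroys that partition, and at most the other one
  remains.\<close>

lemma maximal_if_two_colorings:
  assumes fg: "proper_col k G f" "proper_col k G g"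
    and arcs: "\<And>u v. u \<in> pverts G \<Longrightarrow> v \<in> pverts G \<Longrightarrow> f u \<noteq> f v \<Longrightarrow> g u \<noteq> g v \<Longrightarrow> (u, v) \<in> parcs G"
    and xy: "x \<in> pverts G" "y \<in> pverts G" "f x = f y" "g x \<noteq> g y"
    and two: "\<And>h. proper_col k G h \<Longrightarrow>
      (\<forall>u\<in>pverts G. \<forall>v\<in>pverts G. h u = h v \<longleftrightarrow> f u = f v) \<or>
      (\<forall>u\<in>pverts G. \<forall>v\<in>pverts G. h u = h v \<longleftrightarrow> g u = g v)"
  shows "maximal_ambiguously_colorable k G"
  unfolding maximal_ambiguously_colorable_def
proof (intro conjI ballI impI notI)
  show "ambiguously_colorable k G"
    by (rule ambiguously_colorableI[OF fg xy])
  fix u v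
  assume uv: "u \<in> pverts G" "v \<in> pverts G" "u \<noteq> v \<and> (u, v) \<notin> parcs G"
    and "ambiguously_colorable k (add_edge G u v)"
  then obtain p q a b where pq: "proper_col k G p" "proper_col k G q" "p u \<noteq> p v" "q u \<noteq> q v"
    and ab: "a \<in> pverts G" "b \<in> pverts G" "p a = p b" "q a \<noteq> q b"
    unfolding ambiguously_colorable_add_edge_iff[OF uv(1,2)] by blast
  have "f u = f v \<or> g u = g v"
    using arcs uv by blast
  moreover have "p u = p v" if "\<forall>u\<in>pverts G. \<forall>v\<in>pverts G. p u = p v \<longleftrightarrow> h u = h v" "h u = h v" for p h :: "'a \<Rightarrow> nat"
    using that uv(1,2) by blast
  ultimately have "(\<forall>a\<in>pverts G. \<forall>b\<in>pverts G. p a = p b \<longleftrightarrow> f a = f b) \<and>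
      (\<forall>a\<in>pverts G. \<forall>b\<in>pverts G. q a = q b \<longleftrightarrow> f a = f b) \<or>
      (\<forall>a\<in>pverts G. \<forall>b\<in>pverts G. p a = p b \<longleftrightarrow> g a = g b) \<and>
      (\<forall>a\<in>pverts G. \<forall>b\<in>pverts G. q a = q b \<longleftrightarrow> g a = g b)"
    using two[OF pq(1)] two[OF pq(2)] pq(3,4) by blast
  then have "p a = p b \<longleftrightarrow> q a = q b"
    using ab(1,2) by (elim disjE) simp_all
  then show False
    using ab(3,4) by simp
qed

text \<open>The vertex \<open>w\<close> in the only nonzero cell off the diagonal is the only one
  whose row and column differ, so a colouring has a single binary choice to make.\<close>

lemma special_imp_maximal:
  assumes G: "pair_graph G" and A: "A \<in> carrier_mat k k" and sp: "special A"
    and rep: "represents A G f g"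
  shows "maximal_ambiguously_colorable k G"
proof -
  interpret pair_graph G by fact
  let ?V = "pverts G"
  note nz = represents_nonzero_iff[OF rep A pair_finite_verts]
  have diag: "A $$ (i, i) \<noteq> 0" if "i < k" for i
    using sp A that by (auto simp: special_def)
  obtain i j where ij: "i < k" "j < k" "i \<noteq> j" "A $$ (i, j) = 1"
    and off: "\<And>i' j'. i' < k \<Longrightarrow> j' < k \<Longrightarrow> i' \<noteq> j' \<Longrightarrow> (i', j') \<noteq> (i, j) \<Longrightarrow> A $$ (i', j') = 0"
    using sp A by (auto simp: special_def)
  have lt: "f v < k" "g v < k" if "v \<in> ?V" for v
    using representsD(1)[OF rep that] A by auto
  have "card {v \<in> ?V. f v = i \<and> g v = j} = 1"
    using representsD(2)[OF rep, of i j] ij A by simp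
  then obtain w where w: "{v \<in> ?V. f v = i \<and> g v = j} = {w}"
    using card_1_singletonE by blast
  then have w': "w \<in> ?V" "f w = i" "g w = j"
    by blast+
  have w_unique: "v = w" if "v \<in> ?V" "f v = i" "g v = j" for v
  proof -
    have "v \<in> {v \<in> ?V. f v = i \<and> g v = j}"
      using that by simp
    then show ?thesis
      unfolding w by simp
  qed
  have eq: "f v = g v" if "v \<in> ?V" "v \<noteq> w" for v
  proof (rule ccontr)
    assume "f v \<noteq> g v"
    moreover have "(f v, g v) \<noteq> (i, j)"
      using w_unique[OF that(1)] that(2) by blast
    ultimately have "A $$ (f v, g v) = 0"
      by (intro off lt[OF that(1)])
    then show False
      using nz[OF lt[OF that(1)]] that(1) by blast
  qed
  obtain r where r: "\<And>i. i < k \<Longrightarrow> r i \<in> ?V \<and> f (r i) = i \<and> g (r i) = i"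
    using represents_transversal[OF rep A pair_finite_verts diag] by blast
  show ?thesis
  proof (rule maximal_if_two_colorings[OF represents_imp_proper_col[OF rep A]])
    show "u \<in> ?V \<Longrightarrow> v \<in> ?V \<Longrightarrow> f u \<noteq> f v \<Longrightarrow> g u \<noteq> g v \<Longrightarrow> (u, v) \<in> parcs G" for u v
      using representsD(3)[OF rep] by simp
    show "w \<in> ?V" "r i \<in> ?V" "f w = f (r i)" "g w \<noteq> g (r i)"
      using w' r ij by auto
    fix h assume h: "proper_col k G h"
    have "\<exists>s. (\<forall>v\<in>?V. s v = f v \<or> s v = g v) \<and> (\<forall>u\<in>?V. \<forall>v\<in>?V. h u = h v \<longleftrightarrow> s u = s v)"
    proof (rule coloring_from_transversal)
      show "h ` ?V \<subseteq> {..<k}"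
        using h by (simp add: proper_col_def)
      show "u \<in> ?V \<Longrightarrow> v \<in> ?V \<Longrightarrow> f u \<noteq> f v \<Longrightarrow> g u \<noteq> g v \<Longrightarrow> h u \<noteq> h v" for u v
        using representsD(3)[OF rep] proper_colD(2)[OF h] by simp
    qed (fact r)
    then obtain s where s: "\<And>v. v \<in> ?V \<Longrightarrow> s v = f v \<or> s v = g v"
      "\<And>u v. u \<in> ?V \<Longrightarrow> v \<in> ?V \<Longrightarrow> h u = h v \<longleftrightarrow> s u = s v"
      by blast
    have "s v = f v" if "v \<in> ?V" "v \<noteq> w" for v
      using s(1)[OF that(1)] eq[OF that] by simp
    moreover have "s v = g v" if "v \<in> ?V" "v \<noteq> w" for v
      using s(1)[OF that(1)] eq[OF that] by simp
    ultimately have "(\<forall>v\<in>?V. s v = f v) \<or> (\<forall>v\<in>?V. s v = g v)"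
      using s(1)[OF w'(1)] by blast
    then show "(\<forall>u\<in>?V. \<forall>v\<in>?V. h u = h v \<longleftrightarrow> f u = f v) \<or> (\<forall>u\<in>?V. \<forall>v\<in>?V. h u = h v \<longleftrightarrow> g u = g v)"
      using s(2) by (elim disjE) simp_all
  qed
qed

text \<open>A colouring chooses row or column for each vertex. The colours that have taken an
  off-diagonal vertex of their column form a set that no arc leaves; by strong connectivity it is
  empty or all of \<open>{..<r}\<close>. If it is empty, all vertices follow their rows. If it is
  full, no off-diagonal vertex can follow its row, because that class already contains a vertex
  adjacent to it.\<close>

lemma normal_imp_maximal:
  assumes G: "pair_graph G" and A: "A \<in> carrier_mat k k" and no: "normal A"
    and rep: "represents A G f g"
  shows "maximal_ambiguously_colorable k G"
proof -
  interpret pair_graph G by fact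
  let ?V = "pverts G"
  note nz = represents_nonzero_iff[OF rep A pair_finite_verts]
  obtain r where P: "normal_form A k r"
    using no unfolding normal_iff[OF A] ..
  note r = normal_formD(1,2)[OF P] and diag = normal_formD(3)[OF P]
    and off = normal_formD(4)[OF P] and irr = normal_formD(5)[OF P]
  have lt: "f v < k" "g v < k" if "v \<in> ?V" for v
    using representsD(1)[OF rep that] A by auto
  have lt_r: "f v < r" "g v < r" if "v \<in> ?V" "f v \<noteq> g v" for v
  proof -
    have "A $$ (f v, g v) \<noteq> 0"
      using nz[OF lt[OF that(1)]] that(1) by blast
    then show "f v < r" "g v < r"
      using off[OF lt[OF that(1)] that(2)] by simp_all
  qed
  obtain t where t: "\<And>i. i < k \<Longrightarrow> t i \<in> ?V \<and> f (t i) = i \<and> g (t i) = i"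
    using represents_transversal[OF rep A pair_finite_verts diag] by blast
  \<comment> \<open>Irreducibility applied to \<open>{0}\<close> gives an off-diagonal vertex in row
    \<open>0\<close>, which shows that \<open>f\<close> and \<open>g\<close> differ.\<close>
  have "1 \<in> {..<r}" "{0} \<subseteq> {..<r}"
    using r(1) by auto
  then have "{0} \<noteq> {..<r}"
    by auto
  with irr[of "{0}"] \<open>{0} \<subseteq> {..<r}\<close> obtain j where j: "j < r" "j \<noteq> 0" "A $$ (0, j) \<noteq> 0"
    by auto
  moreover have "0 < k" "j < k"
    using j(1) r by simp_all
  ultimately obtain w where w: "w \<in> ?V" "f w = 0" "g w = j"
    using nz[of 0 j] by blast
  show ?thesis
  proof (rule maximal_if_two_colorings[OF represents_imp_proper_col[OF rep A]])
    show "u \<in> ?V \<Longrightarrow> v \<in> ?V \<Longrightarrow> f u \<noteq> f v \<Longrightarrow> g u \<noteq> g v \<Longrightarrow> (u, v) \<in> parcs G" for u v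
      using representsD(3)[OF rep] by simp
    show "w \<in> ?V" "t 0 \<in> ?V" "f w = f (t 0)" "g w \<noteq> g (t 0)"
      using w t[of 0] r j by auto
    fix h assume h: "proper_col k G h"
    have "\<exists>s. (\<forall>v\<in>?V. s v = f v \<or> s v = g v) \<and> (\<forall>u\<in>?V. \<forall>v\<in>?V. h u = h v \<longleftrightarrow> s u = s v)"
    proof (rule coloring_from_transversal)
      show "h ` ?V \<subseteq> {..<k}"
        using h by (simp add: proper_col_def)
      show "u \<in> ?V \<Longrightarrow> v \<in> ?V \<Longrightarrow> f u \<noteq> f v \<Longrightarrow> g u \<noteq> g v \<Longrightarrow> h u \<noteq> h v" for u v
        using representsD(3)[OF rep] proper_colD(2)[OF h] by simp
    qed (fact t)
    then obtain s where s: "\<And>v. v \<in> ?V \<Longrightarrow> s v = f v \<or> s v = g v"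
      and hs: "\<And>u v. u \<in> ?V \<Longrightarrow> v \<in> ?V \<Longrightarrow> h u = h v \<longleftrightarrow> s u = s v"
      by blast
    have s_sep: "f u = f v \<or> g u = g v" if "u \<in> ?V" "v \<in> ?V" "s u = s v" for u v
    proof -
      have "h u = h v"
        using hs[OF that(1,2)] that(3) by simp
      then have "(u, v) \<notin> parcs G"
        using proper_colD(2)[OF h that(1,2)] by blast
      then show ?thesis
        using representsD(3)[OF rep that(1,2)] by simp
    qed
    define C where "C = {l. l < r \<and> (\<exists>v\<in>?V. s v = l \<and> g v = l \<and> f v \<noteq> l)}"
    \<comment> \<open>A vertex in cell \<open>(i, j)\<close> with \<open>i\<close> in
      \<open>C\<close> cannot take its row: that class contains \<open>u\<close>, which lies in
      column \<open>i\<close> outside row \<open>i\<close> and is thus adjacent to it. So it takes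
      column \<open>j\<close>, and \<open>j\<close> belongs to \<open>C\<close>.\<close>
    have zero: "A $$ (i, j) = 0" if iC: "i \<in> C" and jC: "j \<in> {..<r} - C" for i j
    proof (rule ccontr)
      assume nzij: "A $$ (i, j) \<noteq> 0"
      have ij: "i < r" "j < r" "i \<noteq> j"
        using iC jC by (auto simp: C_def)
      obtain v where v: "v \<in> ?V" "f v = i" "g v = j"
        using nz[of i j] nzij ij r by (meson less_le_trans)
      obtain u where u: "u \<in> ?V" "s u = i" "g u = i" "f u \<noteq> i"
        using iC by (auto simp: C_def)
      have "s v \<noteq> j"
      proof
        assume "s v = j"
        then have "j \<in> C"
          unfolding C_def using v ij by blast
        then show False
          using jC by simp
      qed
      then have "s v = i"
        using s[OF v(1)] v by simp
      then show False
        using s_sep[OF u(1) v(1)] u v ij by simp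
    qed
    have "C \<subseteq> {..<r}"
      by (auto simp: C_def)
    with zero irr[of C] consider "C = {}" | "C = {..<r}"
      by metis
    then have "(\<forall>v\<in>?V. s v = f v) \<or> (\<forall>v\<in>?V. s v = g v)"
    proof cases
      case 1
      have "s v = f v" if v: "v \<in> ?V" for v
      proof (rule ccontr)
        assume "s v \<noteq> f v"
        then have sv: "s v = g v" "f v \<noteq> g v"
          using s[OF v] by auto
        then have "g v \<in> C"
          unfolding C_def using lt_r(2)[OF v] v by blast
        then show False
          using 1 by simp
      qed
      then show ?thesis by blast
    next
      case 2
      have "s v = g v" if v: "v \<in> ?V" for v
      proof (rule ccontr)
        assume "s v \<noteq> g v"
        then have sv: "s v = f v" "f v \<noteq> g v"
          using s[OF v] by auto
        then have "f v \<in> C"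
          using lt_r(1)[OF v] 2 by simp
        then obtain u where "u \<in> ?V" "s u = f v" "g u = f v" "f u \<noteq> f v"
          by (auto simp: C_def)
        then show False
          using s_sep[OF _ v, of u] sv by simp
      qed
      then show ?thesis by blast
    qed
    then show "(\<forall>u\<in>?V. \<forall>v\<in>?V. h u = h v \<longleftrightarrow> f u = f v) \<or> (\<forall>u\<in>?V. \<forall>v\<in>?V. h u = h v \<longleftrightarrow> g u = g v)"
      using hs by (elim disjE) simp_all
  qed
qed

section \<open>Complete multipartite graphs: tiny and small matrices\<close>

lemma card_le_2_mem:
  assumes "finite S" "card S \<le> 2" "a \<in> S" "b \<in> S" "a \<noteq> b" "c \<in> S"
  shows "c = a \<or> c = b"
  using card_seteq[of S "{a, b}"] assms by auto

lemma represents_diagonal: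
  assumes G: "pair_graph G" and A: "A \<in> carrier_mat k k" and diag: "diagonal_mat A"
    and rep: "represents A G f g"
  shows "v \<in> pverts G \<Longrightarrow> g v = f v"
    and "i < k \<Longrightarrow> card {v \<in> pverts G. f v = i} = A $$ (i, i)"
proof -
  interpret pair_graph G by fact
  have eq: "g v = f v" if "v \<in> pverts G" for v
  proof (rule ccontr)
    assume ne: "g v \<noteq> f v"
    have lt: "f v < k" "g v < k"
      using representsD(1)[OF rep that] A by auto
    then have "A $$ (f v, g v) = 0"
      using diag A ne by (auto simp: diagonal_mat_def)
    then show False
      using represents_nonzero_iff[OF rep A pair_finite_verts lt] that by blast
  qed
  show "v \<in> pverts G \<Longrightarrow> g v = f v"
    by (fact eq)
  assume "i < k"
  then have "A $$ (i, i) = card {v \<in> pverts G. f v = i \<and> g v = i}"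
    using representsD(2)[OF rep, of i i] A by simp
  also have "{v \<in> pverts G. f v = i \<and> g v = i} = {v \<in> pverts G. f v = i}"
    using eq by auto
  finally show "card {v \<in> pverts G. f v = i} = A $$ (i, i)" by simp
qed

lemma proper_col_fresh:
  assumes G: "pair_graph G" and f: "proper_col k G f" and z: "z < k"
    and fz: "\<And>v. v \<in> pverts G \<Longrightarrow> f v \<noteq> z"
  shows "proper_col k G (f(x := z))"
proof -
  interpret pair_graph G by fact
  have "(f(x := z)) u \<noteq> (f(x := z)) v" if "u \<in> pverts G" "v \<in> pverts G" "(u, v) \<in> parcs G" for u v
  proof -
    have "u \<noteq> v"
      using no_loops' that(3) by blast
    then show ?thesis
      using fz[OF that(1)] fz[OF that(2)] proper_colD(2)[OF f that] by (auto simp: fun_upd_def)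
  qed
  moreover have "(f(x := z)) v < k" if "v \<in> pverts G" for v
    using proper_colD(1)[OF f that] z by simp
  ultimately show ?thesis
    by (auto simp only: proper_col_def)
qed

text \<open>Splitting or not splitting the class of colour \<open>i\<close> gives two colourings. An
  added edge \<open>uv\<close> forces apart two vertices of one class, and by \<open>unique\<close>
  this already determines the partition. Only the verification of \<open>unique\<close> differs
  between tiny and small matrices.\<close>

lemma diagonal_imp_maximal:
  assumes G: "pair_graph G" and A: "A \<in> carrier_mat k k" and diag: "diagonal_mat A"
    and rep: "represents A G f g"
    and i: "i < k" "A $$ (i, i) = 2" and z: "z < k" "A $$ (z, z) = 0"
    and unique: "\<And>u v h. u \<in> pverts G \<Longrightarrow> v \<in> pverts G \<Longrightarrow> u \<noteq> v \<Longrightarrow> f u = f v \<Longrightarrow>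
      proper_col k G h \<Longrightarrow> h u \<noteq> h v \<Longrightarrow>
      \<forall>a\<in>pverts G. \<forall>b\<in>pverts G. h a = h b \<longleftrightarrow> (f(u := z)) a = (f(u := z)) b"
  shows "maximal_ambiguously_colorable k G"
  unfolding maximal_ambiguously_colorable_def
proof (intro conjI ballI impI notI)
  interpret pair_graph G by fact
  let ?V = "pverts G"
  note eq = represents_diagonal(1)[OF G A diag rep]
  note card = represents_diagonal(2)[OF G A diag rep]
  have f: "proper_col k G f"
    by (rule represents_imp_proper_col(1)[OF rep A])
  have arcs: "(u, v) \<in> parcs G \<longleftrightarrow> f u \<noteq> f v" if "u \<in> ?V" "v \<in> ?V" for u v
    using representsD(3)[OF rep that] eq that by simp
  have fz: "f v \<noteq> z" if "v \<in> ?V" for v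
    using card[OF z(1)] z(2) that by auto
  obtain x y where "{v \<in> ?V. f v = i} = {x, y}" "x \<noteq> y"
    using card[OF i(1)] i(2) by (auto simp: card_2_iff)
  then have xy: "x \<in> ?V" "y \<in> ?V" "f x = i" "f y = i" "x \<noteq> y"
    by blast+
  have "proper_col k G (f(x := z))"
    by (rule proper_col_fresh[OF G f z(1) fz])
  moreover have "(f(x := z)) x \<noteq> (f(x := z)) y"
    using xy(5) fz[OF xy(2)] by simp
  moreover have "f x = f y"
    using xy(3,4) by simp
  ultimately show "ambiguously_colorable k G"
    using f xy(1,2) by (intro ambiguously_colorableI)
  fix u v
  assume uv: "u \<in> pverts G" "v \<in> pverts G" "u \<noteq> v \<and> (u, v) \<notin> parcs G"
    and "ambiguously_colorable k (add_edge G u v)"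
  then obtain p q a b where pq: "proper_col k G p" "proper_col k G q" "p u \<noteq> p v" "q u \<noteq> q v"
    and ab: "a \<in> pverts G" "b \<in> pverts G" "p a = p b" "q a \<noteq> q b"
    unfolding ambiguously_colorable_add_edge_iff[OF uv(1,2)] by blast
  have "f u = f v"
    using arcs uv by blast
  then show False
    using unique[OF uv(1,2) _ _ pq(1,3)] unique[OF uv(1,2) _ _ pq(2,4)] ab uv(3) by simp
qed

lemma small_imp_maximal:
  assumes G: "pair_graph G" and A: "A \<in> carrier_mat k k" and sm: "small A"
    and rep: "represents A G f g"
  shows "maximal_ambiguously_colorable k G"
proof -
  interpret pair_graph G by fact
  let ?V = "pverts G"
  have diag: "diagonal_mat A"
    using sm by (simp add: small_def)
  note eq = represents_diagonal(1)[OF G A diag rep]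
  note card = represents_diagonal(2)[OF G A diag rep]
  obtain i where i: "i < k" "A $$ (i, i) = 2"
    using sm A by (auto simp: small_def)
  have le2: "A $$ (i, i) \<le> 2" if "i < k" for i
    using sm A that by (auto simp: small_def)
  have "card {i. i < k \<and> A $$ (i, i) = 0} = 1"
    using sm A by (auto simp: small_def)
  then obtain z where Z: "{i. i < k \<and> A $$ (i, i) = 0} = {z}"
    using card_1_singletonE by blast
  then have z: "z < k" "A $$ (z, z) = 0"
    by auto
  have lt: "f v < k" if "v \<in> ?V" for v
    using representsD(1)[OF rep that] A by auto
  show ?thesis
  proof (rule diagonal_imp_maximal[OF G A diag rep i z])
    fix u v h
    assume uv: "u \<in> ?V" "v \<in> ?V" "u \<noteq> v" "f u = f v" and h: "proper_col k G h" "h u \<noteq> h v"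
    let ?f = "f(u := z)"
    have "\<exists>x. x \<in> ?V \<and> ?f x = j" if j: "j < k" for j
    proof -
      consider "j = z" | "j = f u" "j \<noteq> z" | "j \<noteq> z" "j \<noteq> f u"
        by blast
      then show ?thesis
      proof cases
        case 1
        have "?f u = z" by simp
        with 1 uv(1) show ?thesis by blast
      next
        case 2
        have "?f v = f u"
          using uv(3,4) by simp
        with 2 uv(2) show ?thesis by blast
      next
        case 3
        have "A $$ (j, j) \<noteq> 0"
        proof
          assume "A $$ (j, j) = 0"
          then have "j \<in> {i. i < k \<and> A $$ (i, i) = 0}"
            using j by simp
          then show False
            unfolding Z using 3 by simp
        qed
        then obtain x where x: "x \<in> ?V" "f x = j"
          using represents_nonzero_iff[OF rep A pair_finite_verts j j] by blast
        then have "x \<noteq> u"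
          using 3(2) by blast
        then have "?f x = j"
          using x(2) by simp
        with x(1) show ?thesis by blast
      qed
    qed
    then have "\<forall>j\<in>{..<k}. \<exists>x. x \<in> ?V \<and> ?f x = j"
      by simp
    from bchoice[OF this] obtain t where "\<forall>j\<in>{..<k}. t j \<in> ?V \<and> ?f (t j) = j" ..
    then have t: "t j \<in> ?V \<and> ?f (t j) = j \<and> ?f (t j) = j" if "j < k" for j
      using that by blast
    have pair: "c = u \<or> c = v" if "c \<in> ?V" "f c = f u" for c
      using card_le_2_mem[of "{x \<in> ?V. f x = f u}" u v c] card[OF lt[OF uv(1)]]
        le2[OF lt[OF uv(1)]] uv that by simp
    have sep: "h a \<noteq> h b" if ab: "a \<in> ?V" "b \<in> ?V" "?f a \<noteq> ?f b" for a b
    proof (cases "f a = f b")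
      case False
      then have "(a, b) \<in> parcs G"
        using representsD(3)[OF rep ab(1,2)] eq[OF ab(1)] eq[OF ab(2)] by simp
      then show ?thesis
        using proper_colD(2)[OF h(1) ab(1,2)] by blast
    next
      case True
      moreover from this have "a = u \<and> b \<noteq> u \<or> b = u \<and> a \<noteq> u"
        using ab(3) by (auto split: if_splits)
      ultimately have "a = u \<and> b = v \<or> a = v \<and> b = u"
        using pair[OF ab(1)] pair[OF ab(2)] by auto
      then show ?thesis
        using h(2) by auto
    qed
    have "h ` ?V \<subseteq> {..<k}"
      using h(1) by (simp add: proper_col_def)
    \<comment> \<open>With \<open>f(u := z)\<close> as row and as column labelling there is no
      choice between row and column, so \<open>h\<close> must have the same classes.\<close>
    then have "\<exists>s. (\<forall>v\<in>?V. s v = ?f v \<or> s v = ?f v) \<and>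
        (\<forall>a\<in>?V. \<forall>b\<in>?V. h a = h b \<longleftrightarrow> s a = s b)"
      using t sep by (intro coloring_from_transversal[where r = t and k = k])
    then obtain s where s: "\<And>v. v \<in> ?V \<Longrightarrow> s v = ?f v"
      and hs: "\<And>a b. a \<in> ?V \<Longrightarrow> b \<in> ?V \<Longrightarrow> h a = h b \<longleftrightarrow> s a = s b"
      by blast
    show "\<forall>a\<in>?V. \<forall>b\<in>?V. h a = h b \<longleftrightarrow> ?f a = ?f b"
      by (intro ballI) (simp only: hs s)
  qed
qed

text \<open>\<open>u\<close> and \<open>v\<close> are the only two vertices that share a colour.
  Once they are separated, \<open>h\<close> and \<open>f(u := z)\<close> both give the partition
  into singletons.\<close>

lemma tiny_imp_maximal:
  assumes G: "pair_graph G" and A: "A \<in> carrier_mat k k" and ti: "tiny A"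
    and rep: "represents A G f g"
  shows "maximal_ambiguously_colorable k G"
proof -
  interpret pair_graph G by fact
  let ?V = "pverts G"
  have diag: "diagonal_mat A"
    using ti by (simp add: tiny_def)
  note eq = represents_diagonal(1)[OF G A diag rep]
  note card = represents_diagonal(2)[OF G A diag rep]
  obtain i where i: "i < k" "A $$ (i, i) = 2"
    and le1: "\<And>j. j < k \<Longrightarrow> j \<noteq> i \<Longrightarrow> A $$ (j, j) \<le> 1"
    using ti A by (auto simp: tiny_def)
  have "2 \<le> card {i. i < k \<and> A $$ (i, i) = 0}"
    using ti A by (simp add: tiny_def)
  then have "{i. i < k \<and> A $$ (i, i) = 0} \<noteq> {}"
    by (intro notI) simp
  then obtain z where z: "z < k" "A $$ (z, z) = 0"
    by blast
  have fz: "f v \<noteq> z" if "v \<in> ?V" for v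
    using card[OF z(1)] z(2) that by auto
  have lt: "f v < k" if "v \<in> ?V" for v
    using representsD(1)[OF rep that] A by auto
  have at_i: "f a = i" if "a \<in> ?V" "b \<in> ?V" "a \<noteq> b" "f a = f b" for a b
  proof (rule ccontr)
    assume "f a \<noteq> i"
    then have "card {v \<in> ?V. f v = f a} \<le> Suc 0"
      using card[OF lt[OF that(1)]] le1[OF lt[OF that(1)]] by simp
    moreover have "a \<in> {v \<in> ?V. f v = f a}" "b \<in> {v \<in> ?V. f v = f a}"
      using that by simp_all
    moreover have "finite {v \<in> ?V. f v = f a}"
      using pair_finite_verts by simp
    ultimately show False
      using card_mono[of "{v \<in> ?V. f v = f a}" "{a, b}"] that(3) by simp
  qed
  show ?thesis
  proof (rule diagonal_imp_maximal[OF G A diag rep i z])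
    fix u v h
    assume uv: "u \<in> ?V" "v \<in> ?V" "u \<noteq> v" "f u = f v" and h: "proper_col k G h" "h u \<noteq> h v"
    let ?f = "f(u := z)"
    have pair: "c = u \<or> c = v" if "c \<in> ?V" "f c = i" for c
      using card_le_2_mem[of "{x \<in> ?V. f x = i}" u v c] card[OF i(1)] i(2)
        at_i[OF uv] uv that by simp
    have "h a \<noteq> h b \<and> ?f a \<noteq> ?f b" if ab: "a \<in> ?V" "b \<in> ?V" "a \<noteq> b" for a b
    proof (cases "f a = f b")
      case False
      then have "(a, b) \<in> parcs G"
        using representsD(3)[OF rep ab(1,2)] eq[OF ab(1)] eq[OF ab(2)] by simp
      then have "h a \<noteq> h b"
        using proper_colD(2)[OF h(1) ab(1,2)] by blast
      moreover have "?f a \<noteq> ?f b"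
        using False fz[OF ab(1)] fz[OF ab(2)] ab(3) by auto
      ultimately show ?thesis ..
    next
      case True
      then have "f a = i" "f b = i"
        using at_i[OF ab] by simp_all
      then have "a = u \<and> b = v \<or> a = v \<and> b = u"
        using pair[OF ab(1)] pair[OF ab(2)] ab(3) by auto
      then show ?thesis
        using h(2) fz[OF uv(2)] uv(3) by (elim disjE) auto
    qed
    then have sep: "h a \<noteq> h b" "?f a \<noteq> ?f b" if "a \<in> ?V" "b \<in> ?V" "a \<noteq> b" for a b
      using that by blast+
    show "\<forall>a\<in>?V. \<forall>b\<in>?V. h a = h b \<longleftrightarrow> ?f a = ?f b"
    proof (intro ballI)
      fix a b assume "a \<in> ?V" "b \<in> ?V"
      then show "h a = h b \<longleftrightarrow> ?f a = ?f b"
        using sep[of a b] by (cases "a = b") simp_all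
    qed
  qed
qed

section \<open>Hall's marriage theorem\<close>

text \<open>The induction of Halmos and Vaughan: a tight proper subfamily \<open>J\<close> is
  matched on its own, and the others avoid its neighbourhood \<open>U\<close>. Without a tight
  subfamily, one index may take any of its neighbours, because the surplus elsewhere absorbs the
  loss of a single element.\<close>

lemma hall_marriage:
  fixes N :: "'i \<Rightarrow> 'b set"
  assumes "finite I" "\<And>i. i \<in> I \<Longrightarrow> finite (N i)"
    and "\<And>J. J \<subseteq> I \<Longrightarrow> card J \<le> card (\<Union>i\<in>J. N i)"
  shows "\<exists>m. inj_on m I \<and> (\<forall>i\<in>I. m i \<in> N i)"
  using assms
proof (induction "card I" arbitrary: I N rule: less_induct)
  case less
  note fin = less.prems(1) and finN = less.prems(2) and hall = less.prems(3)
  have finU: "finite (\<Union>i\<in>J. N i)" if "J \<subseteq> I" for J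
    using that fin finN by (intro finite_UN_I) (auto intro: finite_subset)
  show ?case
  proof (cases "I = {}")
    case True
    then show ?thesis by simp
  next
    case False
    show ?thesis
    proof (cases "\<exists>J. J \<subset> I \<and> J \<noteq> {} \<and> card (\<Union>i\<in>J. N i) \<le> card J")
      case True
      then obtain J where J: "J \<subset> I" "J \<noteq> {}" and tight: "card (\<Union>i\<in>J. N i) \<le> card J"
        by blast
      have JI: "J \<subseteq> I" and finJ: "finite J"
        using J(1) fin finite_subset by auto
      define U where "U = (\<Union>i\<in>J. N i)"
      have finUJ: "finite U"
        unfolding U_def by (rule finU[OF JI])
      have "\<exists>m. inj_on m J \<and> (\<forall>i\<in>J. m i \<in> N i)"
      proof (rule less.hyps)
        show "card J < card I"
          by (rule psubset_card_mono[OF fin J(1)])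
        show "finite (N i)" if "i \<in> J" for i
          using that JI by (intro finN) blast
        show "card K \<le> card (\<Union>i\<in>K. N i)" if "K \<subseteq> J" for K
          using that JI by (intro hall) blast
      qed (fact finJ)
      then obtain m1 where m1: "inj_on m1 J" "\<And>i. i \<in> J \<Longrightarrow> m1 i \<in> N i"
        by blast
      have "\<exists>m. inj_on m (I - J) \<and> (\<forall>i\<in>I - J. m i \<in> N i - U)"
      proof (rule less.hyps)
        show "card (I - J) < card I"
          using J by (intro psubset_card_mono[OF fin]) blast
        show "finite (N i - U)" if "i \<in> I - J" for i
          using that finN by simp
        show "card K \<le> card (\<Union>i\<in>K. N i - U)" if K: "K \<subseteq> I - J" for K
        proof -
          have "finite K" "K \<inter> J = {}" "K \<union> J \<subseteq> I"
            using K fin JI finite_subset[of K I] by auto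
          \<comment> \<open>Hall's condition for \<open>K \<union> J\<close>, minus the at most
            \<open>card J\<close> elements of \<open>U\<close>, is Hall's condition for
            \<open>K\<close> outside \<open>U\<close>.\<close>
          have "card K + card J = card (K \<union> J)"
            using \<open>finite K\<close> finJ \<open>K \<inter> J = {}\<close> by (simp add: card_Un_disjoint)
          also have "\<dots> \<le> card (\<Union>i\<in>K \<union> J. N i)"
            using \<open>K \<union> J \<subseteq> I\<close> by (rule hall)
          also have "(\<Union>i\<in>K \<union> J. N i) = (\<Union>i\<in>K. N i - U) \<union> U"
            by (auto simp: U_def)
          also have "card \<dots> \<le> card (\<Union>i\<in>K. N i - U) + card U"
            by (rule card_Un_le)
          finally show ?thesis
            using tight by (simp add: U_def)
        qed
      qed (use fin in simp)
      then obtain m2 where m2: "inj_on m2 (I - J)" "\<And>i. i \<in> I - J \<Longrightarrow> m2 i \<in> N i - U"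
        by blast
      define m where "m i = (if i \<in> J then m1 i else m2 i)" for i
      have m1U: "m1 i \<in> U" if "i \<in> J" for i
        using m1(2)[OF that] that by (auto simp: U_def)
      have "inj_on m I"
      proof (rule inj_onI)
        fix i j assume ij: "i \<in> I" "j \<in> I" "m i = m j"
        have "i \<in> J \<longleftrightarrow> j \<in> J"
        proof
          assume iJ: "i \<in> J"
          show "j \<in> J"
          proof (rule ccontr)
            assume "j \<notin> J"
            then have "m2 j \<notin> U" "m1 i = m2 j"
              using m2(2)[of j] ij iJ by (auto simp: m_def)
            then show False
              using m1U[OF iJ] by simp
          qed
        next
          assume jJ: "j \<in> J"
          show "i \<in> J"
          proof (rule ccontr)
            assume "i \<notin> J"
            then have "m2 i \<notin> U" "m2 i = m1 j"
              using m2(2)[of i] ij jJ by (auto simp: m_def)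
            then show False
              using m1U[OF jJ] by simp
          qed
        qed
        then show "i = j"
          using inj_onD[OF m1(1), of i j] inj_onD[OF m2(1), of i j] ij
          by (cases "i \<in> J") (simp_all add: m_def)
      qed
      moreover have "m i \<in> N i" if "i \<in> I" for i
        using m1(2)[of i] m2(2)[of i] that by (cases "i \<in> J") (simp_all add: m_def)
      ultimately show ?thesis by blast
    next
      case strict: False
      obtain i where i: "i \<in> I"
        using False by blast
      have "card {i} \<le> card (\<Union>j\<in>{i}. N j)"
        by (rule hall) (use i in simp)
      then have "N i \<noteq> {}"
        by (intro notI) simp
      then obtain y where y: "y \<in> N i"
        by blast
      have "\<exists>m. inj_on m (I - {i}) \<and> (\<forall>j\<in>I - {i}. m j \<in> N j - {y})"
      proof (rule less.hyps)
        show "card (I - {i}) < card I"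
          using i by (intro psubset_card_mono[OF fin]) blast
        show "finite (N j - {y})" if "j \<in> I - {i}" for j
          using that finN by simp
        show "card K \<le> card (\<Union>j\<in>K. N j - {y})" if K: "K \<subseteq> I - {i}" for K
        proof (cases "K = {}")
          case False
          have "K \<subset> I"
            using K i by blast
          then have "card K < card (\<Union>j\<in>K. N j)"
            using strict False by (meson not_le)
          \<comment> \<open>Removing \<open>y\<close> costs at most one element, which the strict
            inequality can afford.\<close>
          also have "card (\<Union>j\<in>K. N j) \<le> Suc (card ((\<Union>j\<in>K. N j) - {y}))"
            using card_Suc_Diff1[of "\<Union>j\<in>K. N j" y] finU[of K] \<open>K \<subset> I\<close>
            by (cases "y \<in> (\<Union>j\<in>K. N j)") simp_all
          also have "(\<Union>j\<in>K. N j) - {y} = (\<Union>j\<in>K. N j - {y})"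
            by blast
          finally show ?thesis by simp
        qed simp
      qed (use fin in simp)
      then obtain m where m: "inj_on m (I - {i})" "\<And>j. j \<in> I - {i} \<Longrightarrow> m j \<in> N j - {y}"
        by blast
      have "inj_on (m(i := y)) (insert i (I - {i}))"
        using m by (intro inj_on_fun_updI[THEN inj_on_insert[THEN iffD2, OF conjI]]) auto
      then have "inj_on (m(i := y)) I"
        using i by (simp add: insert_absorb)
      moreover have "(m(i := y)) j \<in> N j" if "j \<in> I" for j
        using m(2)[of j] y that by (cases "j = i") simp_all
      ultimately show ?thesis by blast
    qed
  qed
qed

section \<open>Maximal graphs are given by desirable matrices\<close>

definition count_mat :: "nat \<Rightarrow> 'a pair_pre_digraph \<Rightarrow> ('a \<Rightarrow> nat) \<Rightarrow> ('a \<Rightarrow> nat) \<Rightarrow> nat mat" where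
  "count_mat k G f g = mat k k (\<lambda>(i, j). card {v \<in> pverts G. f v = i \<and> g v = j})"

lemma count_mat_carrier: "count_mat k G f g \<in> carrier_mat k k"
  by (simp add: count_mat_def)

lemma dim_count_mat [simp]: "dim_row (count_mat k G f g) = k" "dim_col (count_mat k G f g) = k"
  by (simp_all add: count_mat_def)

lemma count_mat_index:
  "i < k \<Longrightarrow> j < k \<Longrightarrow> count_mat k G f g $$ (i, j) = card {v \<in> pverts G. f v = i \<and> g v = j}"
  by (simp add: count_mat_def)

lemma represents_count_mat:
  assumes "proper_col k G f" "proper_col k G g"
    and "\<And>u v. u \<in> pverts G \<Longrightarrow> v \<in> pverts G \<Longrightarrow> (u, v) \<in> parcs G \<longleftrightarrow> f u \<noteq> f v \<and> g u \<noteq> g v"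
  shows "represents (count_mat k G f g) G f g"
  unfolding represents_def
  using proper_colD(1)[OF assms(1)] proper_colD(1)[OF assms(2)] assms(3)
  by (simp add: count_mat_index)

lemma maximal_represents:
  assumes "maximal_ambiguously_colorable k G" "proper_col k G f" "proper_col k G g"
    and "x \<in> pverts G" "y \<in> pverts G" "f x = f y" "g x \<noteq> g y"
  shows "represents (count_mat k G f g) G f g"
  by (rule represents_count_mat[OF assms(2,3)]) (rule maximal_imp_parcs_iff[OF assms])

lemma maximal_add_edge_contradiction:
  assumes "maximal_ambiguously_colorable k G"
    and "a \<in> pverts G" "b \<in> pverts G" "a \<noteq> b" "(a, b) \<notin> parcs G"
    and "proper_col k G p" "proper_col k G q" "p a \<noteq> p b" "q a \<noteq> q b"
    and "x \<in> pverts G" "y \<in> pverts G" "p x = p y" "q x \<noteq> q y"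
  shows False
proof -
  have "\<not> ambiguously_colorable k (add_edge G a b)"
    using assms(1-5) unfolding maximal_ambiguously_colorable_def by blast
  moreover have "ambiguously_colorable k (add_edge G a b)"
    using assms(2,3,6-) by (intro ambiguously_colorableI[of k _ p q x y]) (simp_all add: proper_col_add_edge)
  ultimately show False ..
qed

lemma nonsurjective_coloring_imp_tiny_or_small:
  assumes G: "pair_graph G" and max: "maximal_ambiguously_colorable k G"
    and h: "proper_col k G h" and z: "z < k" and hz: "\<And>v. v \<in> pverts G \<Longrightarrow> h v \<noteq> z"
    and u: "u \<in> pverts G" and v: "v \<in> pverts G" and uv: "u \<noteq> v" "h u = h v"
  shows "\<exists>A\<in>carrier_mat k k. desirable A \<and> represents A G h h"
proof -
  interpret pair_graph G by fact
  let ?V = "pverts G"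
  let ?A = "count_mat k G h h"
  have fresh: "proper_col k G (h(a := z))" for a
    by (rule proper_col_fresh[OF G h z hz])
  have arcs: "(a, b) \<in> parcs G \<longleftrightarrow> h a \<noteq> h b" if "a \<in> ?V" "b \<in> ?V" for a b
  proof -
    have "(a, b) \<in> parcs G \<longleftrightarrow> h a \<noteq> h b \<and> (h(u := z)) a \<noteq> (h(u := z)) b"
      by (rule maximal_imp_parcs_iff[OF max h fresh u v uv(2) _ that])
        (use uv(1) hz[OF v] in simp)
    moreover have "(h(u := z)) a \<noteq> (h(u := z)) b" if "h a \<noteq> h b"
      using that hz[OF \<open>a \<in> ?V\<close>] hz[OF \<open>b \<in> ?V\<close>] by auto
    ultimately show ?thesis by blast
  qed
  have rep: "represents ?A G h h"
    by (rule represents_count_mat[OF h h]) (simp add: arcs)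
  have off: "?A $$ (i, j) = 0" if "i < k" "j < k" "i \<noteq> j" for i j
  proof -
    have "{w \<in> ?V. h w = i \<and> h w = j} = {}"
      using that(3) by blast
    then show ?thesis
      unfolding count_mat_index[OF that(1,2)] by simp
  qed
  then have diag: "diagonal_mat ?A"
    by (simp add: diagonal_mat_def)
  have card: "?A $$ (i, i) = card {w \<in> ?V. h w = i}" if "i < k" for i
    using count_mat_index[OF that that, of G h h] by simp
  have fin: "finite {w \<in> ?V. h w = i}" for i
    using pair_finite_verts by simp
  \<comment> \<open>With \<open>a\<close>, \<open>b\<close>, \<open>c\<close> in one class, moving
    \<open>a\<close> to \<open>z\<close> and moving \<open>b\<close> to \<open>z\<close> both
    survive the edge \<open>ab\<close>, but only the latter separates \<open>b\<close> from
    \<open>c\<close>.\<close>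
  have le2: "?A $$ (i, i) \<le> 2" if "i < k" for i
  proof (rule ccontr)
    assume "\<not> ?thesis"
    then have "3 \<le> card {w \<in> ?V. h w = i}"
      using card[OF that] by simp
    then obtain T where T: "T \<subseteq> {w \<in> ?V. h w = i}" "card T = 3"
      by (meson obtain_subset_with_card_n)
    then obtain a b c where abc: "T = {a, b, c}" "a \<noteq> b" "b \<noteq> c" "a \<noteq> c"
      using card_3_iff by metis
    then have abcV: "a \<in> ?V" "b \<in> ?V" "c \<in> ?V" and eq: "h a = i" "h b = i" "h c = i"
      using T(1) by blast+
    show False
    proof (rule maximal_add_edge_contradiction[OF max abcV(1,2) abc(2) _ fresh fresh _ _ abcV(2,3)])
      show "(a, b) \<notin> parcs G"
        using arcs[OF abcV(1,2)] eq by simp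
      show "(h(a := z)) a \<noteq> (h(a := z)) b" "(h(b := z)) a \<noteq> (h(b := z)) b"
        using abc(2) hz[OF abcV(1)] hz[OF abcV(2)] by auto
      show "(h(a := z)) b = (h(a := z)) c"
        using abc(2,4) eq by simp
      show "(h(b := z)) b \<noteq> (h(b := z)) c"
        using abc(3) hz[OF abcV(3)] by simp
    qed
  qed
  have hu: "h u < k"
    by (rule proper_colD(1)[OF h u])
  have "card {u, v} \<le> card {w \<in> ?V. h w = h u}"
    using u v uv(2) by (intro card_mono[OF fin]) simp
  then have two: "?A $$ (h u, h u) = 2"
    using le2[OF hu] card[OF hu] uv(1) by simp
  let ?Z = "{i. i < k \<and> ?A $$ (i, i) = 0}"
  have empty: "?A $$ (i, i) = 0 \<longleftrightarrow> (\<forall>w\<in>?V. h w \<noteq> i)" if "i < k" for i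
    unfolding card[OF that] using fin[of i] by (simp add: card_eq_0_iff) blast
  have zZ: "z \<in> ?Z"
    using z hz empty[OF z] by simp
  have finZ: "finite ?Z"
    by simp
  have "desirable ?A"
  proof (cases "card ?Z = 1")
    case True
    have "\<exists>i<k. ?A $$ (i, i) = 2"
      using hu two by blast
    then have "small ?A"
      using diag le2 True by (simp add: small_def)
    then show ?thesis
      by (simp add: desirable_def)
  next
    case False
    have "card ?Z \<noteq> 0"
      using zZ finZ by (simp only: card_eq_0_iff) blast
    with False have card_Z: "2 \<le> card ?Z"
      by linarith
    have "\<not> ?Z \<subseteq> {z}"
      using card_mono[of "{z}" ?Z] card_Z by (intro notI) simp
    then obtain z' where z': "z' \<in> ?Z" "z' \<noteq> z"
      unfolding subset_eq Bex_def[symmetric] by (metis singletonI)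
    then have z'k: "z' < k"
      by simp
    have hz': "h w \<noteq> z'" if "w \<in> ?V" for w
      using empty[OF z'k] z'(1) that by simp
    have le1: "?A $$ (j, j) \<le> 1" if j: "j < k" "j \<noteq> h u" for j
    proof (rule ccontr)
      assume "\<not> ?thesis"
      then have "2 \<le> card {w \<in> ?V. h w = j}"
        using card[OF j(1)] by simp
      then obtain T where T: "T \<subseteq> {w \<in> ?V. h w = j}" "card T = 2"
        by (meson obtain_subset_with_card_n)
      then obtain a b where ab: "T = {a, b}" "a \<noteq> b"
        using card_2_iff by metis
      then have abV: "a \<in> ?V" "b \<in> ?V" and eq: "h a = j" "h b = j"
        using T(1) by blast+
      have ne: "a \<noteq> u" "a \<noteq> v" "b \<noteq> u"
        using eq j(2) uv(2) by auto
      show False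
      proof (rule maximal_add_edge_contradiction[OF max abV ab(2) _ fresh _ _ _ u v])
        show "(a, b) \<notin> parcs G"
          using arcs[OF abV] eq by simp
        show "proper_col k G (h(a := z, u := z'))"
          by (rule proper_col_fresh[OF G fresh z'k]) (use hz' z'(2) in auto)
        show "(h(a := z)) a \<noteq> (h(a := z)) b"
          using ab(2) hz[OF abV(2)] by simp
        show "(h(a := z, u := z')) a \<noteq> (h(a := z, u := z')) b"
          using ab(2) ne hz[OF abV(2)] by simp
        show "(h(a := z)) u = (h(a := z)) v"
          using ne uv(2) by simp
        show "(h(a := z, u := z')) u \<noteq> (h(a := z, u := z')) v"
          using ne uv(1) hz'[OF v] by simp
      qed
    qed
    have "\<exists>i<k. ?A $$ (i, i) = 2 \<and> (\<forall>j<k. j \<noteq> i \<longrightarrow> ?A $$ (j, j) \<le> 1)"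
      using hu two le1 by (intro exI[of _ "h u"]) simp
    then have "tiny ?A"
      unfolding tiny_def dim_count_mat using diag card_Z by (intro conjI)
    then show ?thesis
      by (simp add: desirable_def)
  qed
  then show ?thesis
    using rep count_mat_carrier by blast
qed

section \<open>A nonzero diagonal from Hall's theorem\<close>

lemma proper_col_few_classes:
  fixes c :: "'a \<Rightarrow> 'c"
  assumes "finite S" "card S < k" "c ` pverts G \<subseteq> S"
    and "\<And>u v. u \<in> pverts G \<Longrightarrow> v \<in> pverts G \<Longrightarrow> (u, v) \<in> parcs G \<Longrightarrow> c u \<noteq> c v"
  shows "\<exists>h. proper_col k G h \<and> h ` pverts G \<noteq> {..<k}"
proof -
  \<comment> \<open>Numbering the classes below \<open>k - 1\<close> keeps the colour
    \<open>k - 1\<close> free. As \<open>card S < k\<close> excludes \<open>k = 0\<close>, the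
    truncated subtraction does no harm.\<close>
  have "card S \<le> card {..<k - 1}"
    using assms(2) by simp
  then obtain e where e: "e ` S \<subseteq> {..<k - 1}" "inj_on e S"
    using card_le_inj[OF assms(1) finite_lessThan] by blast
  have cS: "c v \<in> S" if "v \<in> pverts G" for v
    using assms(3) that by blast
  have lt: "e (c v) < k - 1" if "v \<in> pverts G" for v
    using e(1) cS[OF that] by blast
  have "e (c u) \<noteq> e (c v)" if "u \<in> pverts G" "v \<in> pverts G" "(u, v) \<in> parcs G" for u v
    using assms(4)[OF that] inj_onD[OF e(2), of "c u" "c v"] cS[OF that(1)] cS[OF that(2)] by blast
  moreover have "e (c v) < k" if "v \<in> pverts G" for v
    using lt[OF that] by simp
  ultimately have "proper_col k G (\<lambda>v. e (c v))"
    by (auto simp only: proper_col_def)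
  moreover have "k - 1 \<notin> (\<lambda>v. e (c v)) ` pverts G"
    using lt by force
  moreover have "k - 1 \<in> {..<k}"
    using assms(2) by simp
  ultimately show ?thesis
    by (intro exI[of _ "\<lambda>v. e (c v)"]) blast
qed

text \<open>A line cover of the nonzero cells by fewer than \<open>k\<close> lines would be a colouring with fewer
  than \<open>k\<close> classes, so Hall's condition holds and the columns can be permuted to make the
  diagonal nonzero.\<close>

lemma surjective_colorings_imp_transversal:
  assumes G: "pair_graph G"
    and surj: "\<And>h. proper_col k G h \<Longrightarrow> h ` pverts G = {..<k}"
    and f: "proper_col k G f" and g: "proper_col k G g"
  shows "\<exists>\<pi> r. inj_on \<pi> {..<k} \<and> \<pi> ` {..<k} \<subseteq> {..<k} \<and>
    (\<forall>i<k. r i \<in> pverts G \<and> f (r i) = i \<and> \<pi> (g (r i)) = i)"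
proof -
  interpret pair_graph G by fact
  let ?V = "pverts G"
  define N where "N i = g ` {v \<in> ?V. f v = i}" for i
  have Nk: "N i \<subseteq> {..<k}" for i
    using proper_colD(1)[OF g] by (auto simp: N_def)
  have "\<exists>m. inj_on m {..<k} \<and> (\<forall>i\<in>{..<k}. m i \<in> N i)"
  proof (rule hall_marriage)
    show "finite (N i)" for i
      using Nk finite_subset by blast
    show "card J \<le> card (\<Union>i\<in>J. N i)" if J: "J \<subseteq> {..<k}" for J
    proof (rule ccontr)
      assume less: "\<not> ?thesis"
      \<comment> \<open>Rows in \<open>J\<close> are covered by the columns that meet them
        (\<open>Inr\<close>), the remaining rows by themselves (\<open>Inl\<close>). If
        \<open>J\<close> violates Hall's condition, these are fewer than \<open>k\<close>
        lines.\<close>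
      define c where "c v = (if f v \<in> J then Inr (g v) else Inl (f v))" for v
      let ?S = "({..<k} - J) <+> (\<Union>i\<in>J. N i)"
      have finJ: "finite J"
        using J finite_subset by blast
      then have finU: "finite (\<Union>i\<in>J. N i)"
        by (simp add: N_def)
      have "card ?S = k - card J + card (\<Union>i\<in>J. N i)"
        using finJ finU J by (simp add: card_Plus card_Diff_subset)
      moreover have "card J \<le> k"
        using card_mono[OF _ J] by simp
      ultimately have "card ?S < k"
        using less by linarith
      moreover have "finite ?S"
        using finU by simp
      moreover have "c v \<in> ?S" if "v \<in> ?V" for v
        using proper_colD(1)[OF f that] that by (auto simp: c_def N_def)
      moreover have "c u \<noteq> c v" if "u \<in> ?V" "v \<in> ?V" "(u, v) \<in> parcs G" for u v
        using proper_colD(2)[OF f that] proper_colD(2)[OF g that] by (simp add: c_def)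
      ultimately have "\<exists>h. proper_col k G h \<and> h ` ?V \<noteq> {..<k}"
        by (intro proper_col_few_classes[of ?S k c]) blast+
      then show False
        using surj by blast
    qed
  qed simp
  then obtain m where m: "inj_on m {..<k}" and mN: "\<And>i. i < k \<Longrightarrow> m i \<in> N i"
    by blast
  have "m ` {..<k} \<subseteq> {..<k}"
    using mN Nk by blast
  then have m_surj: "m ` {..<k} = {..<k}"
    by (intro endo_inj_surj m finite_lessThan)
  \<comment> \<open>Renaming the columns by the inverse of the matching moves the matched cell
    \<open>(i, m i)\<close> to the diagonal.\<close>
  let ?\<pi> = "inv_into {..<k} m"
  have "inj_on ?\<pi> {..<k}"
    using inj_on_inv_into[of "{..<k}" m "{..<k}"] m_surj by simp
  moreover have "?\<pi> ` {..<k} \<subseteq> {..<k}"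
    using inv_into_into[of _ m "{..<k}"] m_surj by blast
  moreover have "\<forall>i\<in>{..<k}. \<exists>v. v \<in> ?V \<and> f v = i \<and> ?\<pi> (g v) = i"
  proof
    fix i assume i: "i \<in> {..<k}"
    then obtain v where v: "v \<in> ?V" "f v = i" "m i = g v"
      using mN[of i] by (auto simp: N_def)
    then have "?\<pi> (g v) = i"
      using inv_into_f_f[OF m i] by simp
    with v show "\<exists>v. v \<in> ?V \<and> f v = i \<and> ?\<pi> (g v) = i"
      by blast
  qed
  from bchoice[OF this] obtain r where "\<forall>i\<in>{..<k}. r i \<in> ?V \<and> f (r i) = i \<and> ?\<pi> (g (r i)) = i" ..
  ultimately show ?thesis
    by (intro exI[of _ ?\<pi>] exI[of _ r]) simp
qed

lemma proper_col_comp: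
  assumes f: "proper_col k G f" and \<pi>: "inj_on \<pi> {..<k}" "\<pi> ` {..<k} \<subseteq> {..<k}"
  shows "proper_col k G (\<lambda>v. \<pi> (f v))"
    and "u \<in> pverts G \<Longrightarrow> v \<in> pverts G \<Longrightarrow> \<pi> (f u) = \<pi> (f v) \<longleftrightarrow> f u = f v"
proof -
  have eq: "\<pi> (f u) = \<pi> (f v) \<longleftrightarrow> f u = f v" if "u \<in> pverts G" "v \<in> pverts G" for u v
    using inj_on_eq_iff[OF \<pi>(1), of "f u" "f v"] proper_colD(1)[OF f] that by simp
  show "u \<in> pverts G \<Longrightarrow> v \<in> pverts G \<Longrightarrow> \<pi> (f u) = \<pi> (f v) \<longleftrightarrow> f u = f v"
    by (rule eq)
  have "\<pi> (f v) < k" if "v \<in> pverts G" for v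
    using \<pi>(2) proper_colD(1)[OF f that] by blast
  moreover have "\<pi> (f u) \<noteq> \<pi> (f v)" if "u \<in> pverts G" "v \<in> pverts G" "(u, v) \<in> parcs G" for u v
    using eq[OF that(1,2)] proper_colD(2)[OF f that] by simp
  ultimately show "proper_col k G (\<lambda>v. \<pi> (f v))"
    by (auto simp only: proper_col_def)
qed

section \<open>The digraph of colours: closed sets and strong components\<close>

lemma rtrancl_crossing:
  assumes "(a, b) \<in> R\<^sup>*" "a \<in> S" "b \<notin> S"
  shows "\<exists>(p, q)\<in>R. p \<in> S \<and> q \<notin> S"
  using assms by (induction rule: rtrancl_induct) blast+

text \<open>Each arc of a path is undone by the rest of a cycle through it.\<close>

lemma rtrancl_sym_if_arcs_on_cycles:
  assumes "\<And>p q. (p, q) \<in> R \<Longrightarrow> (q, p) \<in> R\<^sup>*" "(a, b) \<in> R\<^sup>*"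
  shows "(b, a) \<in> R\<^sup>*"
  using assms(2)
proof (induction rule: rtrancl_induct)
  case (step y z)
  then show ?case
    using assms(1)[OF step.hyps(2)] by (meson rtrancl_trans)
qed simp

text \<open>Vertices that switch to their column get a colour in \<open>C\<close> by closedness, the
  others keep one outside \<open>C\<close>. So the two sides never share a colour, and on each side
  one of the given colourings is used.\<close>

lemma switch_proper_col:
  assumes f: "proper_col k G f" and g: "proper_col k G g"
    and closed: "\<And>v. v \<in> pverts G \<Longrightarrow> f v \<in> C \<Longrightarrow> g v \<in> C"
  shows "proper_col k G (\<lambda>v. if f v \<in> C then g v else f v)" (is "proper_col k G ?s")
proof -
  have "?s v < k" if "v \<in> pverts G" for v
    using proper_colD(1)[OF f that] proper_colD(1)[OF g that] by simp
  moreover have "?s u \<noteq> ?s v" if "u \<in> pverts G" "v \<in> pverts G" "(u, v) \<in> parcs G" for u v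
    using proper_colD(2)[OF f that] proper_colD(2)[OF g that] closed[OF that(1)] closed[OF that(2)]
    by (cases "f u \<in> C"; cases "f v \<in> C") auto
  ultimately show ?thesis
    by (auto simp only: proper_col_def)
qed

text \<open>The matrix of \<open>f\<close>, \<open>g\<close> is viewed as a digraph on the colours, with one arc per vertex of
  \<open>G\<close>. If the arc of \<open>w\<close> lies on no cycle, the set \<open>C\<close> of colours reachable from its head is
  covered by columns and the rest by rows; both lines through \<open>w\<close> are then used.\<close>

lemma arc_off_cycle_imp_special:
  assumes G: "pair_graph G" and max: "maximal_ambiguously_colorable k G"
    and f: "proper_col k G f" and g: "proper_col k G g"
    and r: "\<And>i. i < k \<Longrightarrow> r i \<in> pverts G \<and> f (r i) = i \<and> g (r i) = i"
    and w: "w \<in> pverts G" and off: "(g w, f w) \<notin> ((\<lambda>v. (f v, g v)) ` pverts G)\<^sup>*"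
  shows "\<exists>A\<in>carrier_mat k k. desirable A \<and> (\<exists>p q. represents A G p q)"
proof -
  interpret pair_graph G by fact
  let ?V = "pverts G"
  define R where "R = (\<lambda>v. (f v, g v)) ` ?V"
  define C where "C = {l. (g w, l) \<in> R\<^sup>*}"
  have closed: "g v \<in> C" if "v \<in> ?V" "f v \<in> C" for v
  proof -
    have "(f v, g v) \<in> R"
      using that(1) by (simp add: R_def)
    then show ?thesis
      using that(2) unfolding C_def by (simp add: rtrancl_into_rtrancl)
  qed
  have gwC: "g w \<in> C" and fwC: "f w \<notin> C"
    using off by (simp_all add: C_def R_def)
  then have fg: "f w \<noteq> g w"
    by metis
  define s where "s v = (if f v \<in> C then g v else f v)" for v
  have s: "proper_col k G s"
    unfolding s_def by (rule switch_proper_col[OF f g closed])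
  \<comment> \<open>\<open>s\<close> and \<open>s'\<close> differ only at \<open>w\<close>, which
    moves from its row to its column. So \<open>w\<close> is the only off-diagonal vertex of the new
    matrix.\<close>
  define s' where "s' = s(w := g w)"
  have sw: "s w = f w" and s'w: "s' w = g w"
    using fwC by (simp_all add: s_def s'_def)
  have s'_eq: "s' v = s v" if "v \<noteq> w" for v
    using that by (simp add: s'_def)
  \<comment> \<open>Since \<open>g w\<close> lies in \<open>C\<close>, only vertices of column
    \<open>g w\<close> have this colour under \<open>s\<close>, and these are not adjacent to
    \<open>w\<close>.\<close>
  have sep: "g w \<noteq> s v" if "v \<in> ?V" "f v \<noteq> f w" "g v \<noteq> g w" for v
    using that gwC by (auto simp: s_def)
  have "s' u \<noteq> s' v" if uv: "u \<in> ?V" "v \<in> ?V" "(u, v) \<in> parcs G" for u v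
  proof -
    have ne: "u \<noteq> v"
      using no_loops' uv(3) by blast
    have fne: "f u \<noteq> f v" and gne: "g u \<noteq> g v"
      by (rule proper_colD(2)[OF f uv], rule proper_colD(2)[OF g uv])
    consider "u = w" | "v = w" "u \<noteq> w" | "u \<noteq> w" "v \<noteq> w"
      by blast
    then show ?thesis
    proof cases
      case 1
      then show ?thesis
        using sep[OF uv(2)] fne gne s'w s'_eq[of v] ne by simp
    next
      case 2
      then show ?thesis
        using sep[OF uv(1)] fne gne s'w s'_eq[of u] by simp
    next
      case 3
      then show ?thesis
        using s'_eq proper_colD(2)[OF s uv] by simp
    qed
  qed
  moreover have "s' v < k" if "v \<in> ?V" for v
    using proper_colD(1)[OF s that] proper_colD(1)[OF g w] by (simp add: s'_def)
  ultimately have s': "proper_col k G s'"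
    by (auto simp only: proper_col_def)
  have fw: "f w < k" and gw: "g w < k"
    by (rule proper_colD(1)[OF f w], rule proper_colD(1)[OF g w])
  have rV: "r i \<in> ?V" and sr: "s (r i) = i" and s'r: "s' (r i) = i" if "i < k" for i
  proof -
    have "r i \<noteq> w"
      using r[OF that] fg by metis
    then show "r i \<in> ?V" "s (r i) = i" "s' (r i) = i"
      using r[OF that] s'_eq[of "r i"] by (simp_all add: s_def)
  qed
  let ?A = "count_mat k G s s'"
  have rep: "represents ?A G s s'"
  proof (rule maximal_represents[OF max s s' w rV[OF fw]])
    show "s w = s (r (f w))"
      using sw sr[OF fw] by simp
    show "s' w \<noteq> s' (r (f w))"
      using s'w s'r[OF fw] fg by simp
  qed
  have "?A $$ (i, i) \<noteq> 0" if "i < k" for i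
    using represents_nonzero_iff[OF rep count_mat_carrier pair_finite_verts that that]
      rV[OF that] sr[OF that] s'r[OF that] by blast
  moreover have "?A $$ (f w, g w) = 1"
  proof -
    have "{v \<in> ?V. s v = f w \<and> s' v = g w} = {w}"
    proof (intro equalityI subsetI)
      fix v assume v: "v \<in> {v \<in> ?V. s v = f w \<and> s' v = g w}"
      show "v \<in> {w}"
      proof (rule ccontr)
        assume "v \<notin> {w}"
        then have "s' v = s v"
          using s'_eq by simp
        then show False
          using v fg by simp
      qed
    qed (use w sw s'w in simp)
    then show ?thesis
      by (simp add: count_mat_index fw gw)
  qed
  moreover have "?A $$ (i, j) = 0" if "i < k" "j < k" "i \<noteq> j" "(i, j) \<noteq> (f w, g w)" for i j
  proof (rule ccontr)
    note nz = represents_nonzero_iff[OF rep count_mat_carrier pair_finite_verts that(1,2)]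
    assume "?A $$ (i, j) \<noteq> 0"
    then obtain v where v: "v \<in> ?V" "s v = i" "s' v = j"
      using nz by blast
    show False
    proof (cases "v = w")
      case True
      then show ?thesis
        using v sw s'w that(4) by simp
    next
      case False
      then show ?thesis
        using v s'_eq that(3) by simp
    qed
  qed
  ultimately have "special ?A"
    unfolding special_def dim_count_mat using fw gw fg by blast
  then show ?thesis
    using rep count_mat_carrier unfolding desirable_def by blast
qed

text \<open>This renaming turns a strong component into the leading block required by
  \<open>normal_form\<close>.\<close>

lemma exists_bij_initial_segment:
  assumes "X \<subseteq> {..<k}"
  shows "\<exists>\<pi>. inj_on \<pi> {..<k} \<and> \<pi> ` {..<k} \<subseteq> {..<k} \<and> \<pi> ` X = {..<card X}"
proof -
  have finX: "finite X"
    using assms finite_subset by blast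
  have cardX: "card X \<le> k"
    using card_mono[OF _ assms] by simp
  obtain b1 where b1: "bij_betw b1 X {..<card X}"
    using finite_same_card_bij[OF finX, of "{..<card X}"] by auto
  have "card ({..<k} - X) = card {card X..<k}"
    using finX assms by (simp add: card_Diff_subset)
  then obtain b2 where b2: "bij_betw b2 ({..<k} - X) {card X..<k}"
    using finite_same_card_bij[of "{..<k} - X" "{card X..<k}"] by auto
  define \<pi> where "\<pi> i = (if i \<in> X then b1 i else b2 i)" for i
  have 1: "bij_betw \<pi> X {..<card X}"
    using b1 by (rule bij_betw_cong[THEN iffD1, rotated]) (simp add: \<pi>_def)
  have 2: "bij_betw \<pi> ({..<k} - X) {card X..<k}"
    using b2 by (rule bij_betw_cong[THEN iffD1, rotated]) (simp add: \<pi>_def)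
  have "bij_betw \<pi> (X \<union> ({..<k} - X)) ({..<card X} \<union> {card X..<k})"
    by (rule bij_betw_combine[OF 1 2]) auto
  moreover have "X \<union> ({..<k} - X) = {..<k}" "{..<card X} \<union> {card X..<k} = {..<k}"
    using assms cardX by auto
  ultimately show ?thesis
    using 1 by (intro exI[of _ \<pi>]) (simp add: bij_betw_def)
qed

text \<open>If every arc lies on a cycle, all weak components of the digraph are strongly connected.
  Switching from rows to columns inside one nontrivial component yields a normal matrix.\<close>

lemma arcs_on_cycles_imp_normal:
  assumes G: "pair_graph G" and max: "maximal_ambiguously_colorable k G"
    and f: "proper_col k G f" and g: "proper_col k G g"
    and r: "\<And>i. i < k \<Longrightarrow> r i \<in> pverts G \<and> f (r i) = i \<and> g (r i) = i"
    and w: "w \<in> pverts G" "f w \<noteq> g w"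
    and cyc: "\<And>v. v \<in> pverts G \<Longrightarrow> (g v, f v) \<in> ((\<lambda>v. (f v, g v)) ` pverts G)\<^sup>*"
  shows "\<exists>A\<in>carrier_mat k k. desirable A \<and> (\<exists>p q. represents A G p q)"
proof -
  interpret pair_graph G by fact
  let ?V = "pverts G"
  define R where "R = (\<lambda>v. (f v, g v)) ` ?V"
  have RI: "(f v, g v) \<in> R" if "v \<in> ?V" for v
    using that by (simp add: R_def)
  have arc_cyc: "(q, p) \<in> R\<^sup>*" if "(p, q) \<in> R" for p q
    using that cyc unfolding R_def by blast
  note R_sym = rtrancl_sym_if_arcs_on_cycles[OF arc_cyc]
  \<comment> \<open>Reachability is symmetric here, so \<open>X\<close> is the strong component of
    \<open>f w\<close>. It is nontrivial because it also contains \<open>g w\<close>.\<close>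
  define X where "X = {l. (f w, l) \<in> R\<^sup>*}"
  have fwX: "f w \<in> X"
    by (simp add: X_def)
  have closed: "g v \<in> X" if "v \<in> ?V" "f v \<in> X" for v
    using that RI[OF that(1)] unfolding X_def by (simp add: rtrancl_into_rtrancl)
  have gwX: "g w \<in> X"
    by (rule closed[OF w(1) fwX])
  have Xk: "X \<subseteq> {..<k}"
  proof
    fix l assume "l \<in> X"
    then have "(f w, l) \<in> R\<^sup>*"
      by (simp add: X_def)
    then show "l \<in> {..<k}"
    proof (induction rule: rtrancl_induct)
      case base
      then show ?case
        using proper_colD(1)[OF f w(1)] by simp
    next
      case (step y z)
      then show ?case
        using proper_colD(1)[OF g] by (auto simp: R_def)
    qed
  qed
  have connected: "(a, b) \<in> R\<^sup>*" if "a \<in> X" "b \<in> X" for a b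
  proof -
    have "(f w, a) \<in> R\<^sup>*"
      using that(1) by (simp add: X_def)
    then have "(a, f w) \<in> R\<^sup>*"
      by (rule R_sym[rotated])
    also have "(f w, b) \<in> R\<^sup>*"
      using that(2) by (simp add: X_def)
    finally show ?thesis .
  qed
  \<comment> \<open>Where \<open>f v\<close> is outside \<open>X\<close>, \<open>s\<close> agrees
    with \<open>f\<close> and the arc becomes a loop; the arcs that start in \<open>X\<close> are
    kept, and they stay in \<open>X\<close>.\<close>
  define s where "s v = (if f v \<in> X then g v else f v)" for v
  have s: "proper_col k G s"
    unfolding s_def by (rule switch_proper_col[OF f g closed])
  obtain \<pi> where \<pi>: "inj_on \<pi> {..<k}" "\<pi> ` {..<k} \<subseteq> {..<k}" and \<pi>X: "\<pi> ` X = {..<card X}"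
    using exists_bij_initial_segment[OF Xk] by blast
  have \<pi>_surj: "\<pi> ` {..<k} = {..<k}"
    by (intro endo_inj_surj \<pi> finite_lessThan)
  have \<pi>_less_iff: "\<pi> l < card X" if "l \<in> X" for l
    using \<pi>X that by blast
  define f' where "f' v = \<pi> (f v)" for v
  define s' where "s' v = \<pi> (s v)" for v
  have f': "proper_col k G f'" and s': "proper_col k G s'"
    unfolding f'_def s'_def by (rule proper_col_comp(1)[OF f \<pi>], rule proper_col_comp(1)[OF s \<pi>])
  have sr: "s (r i) = i" if "i < k" for i
    using r[OF that] by (simp add: s_def)
  have fw: "f w < k" and gw: "g w < k"
    by (rule proper_colD(1)[OF f w(1)], rule proper_colD(1)[OF g w(1)])
  have sw: "s w = g w"
    using fwX by (simp add: s_def)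
  let ?A = "count_mat k G f' s'"
  have rep: "represents ?A G f' s'"
  proof (rule maximal_represents[OF max f' s' w(1)])
    show "r (f w) \<in> ?V" "f' w = f' (r (f w))"
      using r[OF fw] by (simp_all add: f'_def)
    have "s w \<noteq> s (r (f w))"
      using sw sr[OF fw] w(2) by simp
    then show "s' w \<noteq> s' (r (f w))"
      unfolding s'_def using proper_col_comp(2)[OF s \<pi> w(1), of "r (f w)"] r[OF fw] by simp
  qed
  note nz = represents_nonzero_iff[OF rep count_mat_carrier pair_finite_verts]
  have "normal_form ?A k (card X)"
  proof (rule normal_formI)
    fix i assume i: "i < k"
    then have "i \<in> \<pi> ` {..<k}"
      using \<pi>_surj by simp
    then obtain l where l: "l < k" "\<pi> l = i"
      by blast
    have "r l \<in> ?V" "f' (r l) = i" "s' (r l) = i"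
      using r[OF l(1)] sr[OF l(1)] l(2) by (simp_all add: f'_def s'_def)
    then show "?A $$ (i, i) \<noteq> 0"
      using nz[OF i i] by blast
  next
    fix i j assume ij: "i < k" "j < k" "i \<noteq> j" "?A $$ (i, j) \<noteq> 0"
    then obtain v where v: "v \<in> ?V" "f' v = i" "s' v = j"
      using nz[OF ij(1,2)] by blast
    then have "f v \<noteq> s v"
      using ij(3) by (metis f'_def s'_def)
    then have fvX: "f v \<in> X" and "s v = g v"
      by (simp_all add: s_def split: if_splits)
    then have "s v \<in> X"
      using closed[OF v(1)] by simp
    then show "i < card X \<and> j < card X"
      using v(2,3) fvX \<pi>_less_iff unfolding f'_def s'_def by blast
  next
    fix I assume I: "I \<subseteq> {..<card X}" "I \<noteq> {}" "I \<noteq> {..<card X}"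
    \<comment> \<open>\<open>J\<close> is \<open>I\<close> in the original names of the colours. An
      arc leaving \<open>J\<close> starts in \<open>X\<close>, hence ends in \<open>X\<close>, and
      so it is one of those kept by \<open>s\<close>.\<close>
    define J where "J = {l \<in> X. \<pi> l \<in> I}"
    obtain i where i: "i \<in> I" "i \<in> \<pi> ` X"
      using I(1,2) unfolding \<pi>X by blast
    then obtain a where a: "a \<in> X" "a \<in> J"
      unfolding J_def by blast
    obtain j where j: "j \<notin> I" "j \<in> \<pi> ` X"
      using I(1,3) unfolding \<pi>X by blast
    then obtain b where b: "b \<in> X" "b \<notin> J"
      unfolding J_def by blast
    obtain p q where pq: "(p, q) \<in> R" "p \<in> J" "q \<notin> J"
      using rtrancl_crossing[OF connected[OF a(1) b(1)] a(2) b(2)] by blast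
    obtain v where v: "v \<in> ?V" "f v = p" "g v = q"
      using pq(1) unfolding R_def by blast
    have pX: "p \<in> X" and pI: "\<pi> p \<in> I"
      using pq(2) by (simp_all add: J_def)
    have qX: "q \<in> X"
      using closed[OF v(1)] v pX by simp
    have qI: "\<pi> q \<notin> I"
      using pq(3) qX by (simp add: J_def)
    have "s v = q"
      using v pX by (simp add: s_def)
    then have "f' v = \<pi> p" "s' v = \<pi> q"
      using v by (simp_all add: f'_def s'_def)
    moreover have "\<pi> p < k" "\<pi> q < k"
      using \<pi>(2) pX qX Xk by blast+
    ultimately have "?A $$ (\<pi> p, \<pi> q) \<noteq> 0"
      using nz[of "\<pi> p" "\<pi> q"] v(1) by blast
    moreover have "\<pi> q \<in> {..<card X} - I"
      using \<pi>_less_iff[OF qX] qI by simp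
    ultimately show "\<exists>i\<in>I. \<exists>j\<in>{..<card X} - I. ?A $$ (i, j) \<noteq> 0"
      using pI by blast
  next
    show "card X \<le> k"
      using card_mono[OF _ Xk] by simp
    have "finite X"
      using Xk finite_subset by blast
    then show "2 \<le> card X"
      using card_mono[of X "{f w, g w}"] fwX gwX w(2) by simp
  qed
  then have "normal ?A"
    using normal_iff[OF count_mat_carrier] by blast
  then show ?thesis
    using rep count_mat_carrier unfolding desirable_def by blast
qed

section \<open>The case distinction for maximal graphs\<close>

lemma maximal_imp_desirable:
  assumes G: "pair_graph G" and max: "maximal_ambiguously_colorable k G"
  shows "\<exists>A\<in>carrier_mat k k. desirable A \<and> (\<exists>p q. represents A G p q)"
proof -
  interpret pair_graph G by fact
  let ?V = "pverts G"
  have "ambiguously_colorable k G"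
    using max by (simp add: maximal_ambiguously_colorable_def)
  then obtain f g x y where f: "proper_col k G f" and g: "proper_col k G g"
    and xy: "x \<in> ?V" "y \<in> ?V" "f x = f y" "g x \<noteq> g y"
    unfolding ambiguously_colorable_iff by blast
  have xy_ne: "x \<noteq> y"
    using xy(4) by blast
  show ?thesis
  proof (cases "\<exists>h. proper_col k G h \<and> h ` ?V \<noteq> {..<k}")
    case True
    then obtain h where h: "proper_col k G h" "h ` ?V \<noteq> {..<k}"
      by blast
    \<comment> \<open>An injective \<open>h\<close> has no class to split. But then there are fewer
      than \<open>k\<close> vertices, so \<open>f\<close>, which identifies \<open>x\<close> and
      \<open>y\<close>, misses a colour as well.\<close>
    have "\<exists>h. proper_col k G h \<and> h ` ?V \<noteq> {..<k} \<and> \<not> inj_on h ?V"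
    proof (cases "inj_on h ?V")
      case False
      then show ?thesis
        using h by blast
    next
      case inj: True
      have "h ` ?V \<subset> {..<k}"
        using h by (auto simp: proper_col_def)
      then have "card ?V < k"
        using psubset_card_mono[of "{..<k}" "h ` ?V"] card_image[OF inj] by simp
      moreover have "card (f ` ?V) \<le> card ?V"
        using card_image_le[OF pair_finite_verts] .
      ultimately have "f ` ?V \<noteq> {..<k}"
        by auto
      moreover have "\<not> inj_on f ?V"
        using xy xy_ne by (auto dest: inj_onD)
      ultimately show ?thesis
        using f by blast
    qed
    then obtain h where h: "proper_col k G h" "h ` ?V \<noteq> {..<k}" "\<not> inj_on h ?V"
      by blast
    have "h ` ?V \<subseteq> {..<k}"
      using h(1) by (simp add: proper_col_def)
    then obtain z where z: "z < k" "z \<notin> h ` ?V"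
      using h(2) by blast
    obtain u v where "u \<in> ?V" "v \<in> ?V" "u \<noteq> v" "h u = h v"
      using h(3) unfolding inj_on_def by blast
    then show ?thesis
      using nonsurjective_coloring_imp_tiny_or_small[OF G max h(1) z(1)] z(2) by blast
  next
    case False
    then have surj: "h ` ?V = {..<k}" if "proper_col k G h" for h
      using that by blast
    obtain \<pi> r where \<pi>: "inj_on \<pi> {..<k}" "\<pi> ` {..<k} \<subseteq> {..<k}"
      and r: "\<And>i. i < k \<Longrightarrow> r i \<in> ?V \<and> f (r i) = i \<and> \<pi> (g (r i)) = i"
      using surjective_colorings_imp_transversal[OF G surj f g] by blast
    define g' where "g' v = \<pi> (g v)" for v
    have g': "proper_col k G g'"
      unfolding g'_def by (rule proper_col_comp(1)[OF g \<pi>])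
    have r': "r i \<in> ?V \<and> f (r i) = i \<and> g' (r i) = i" if "i < k" for i
      using r[OF that] by (simp add: g'_def)
    have "g' x \<noteq> g' y"
      unfolding g'_def using proper_col_comp(2)[OF g \<pi> xy(1,2)] xy(4) by simp
    \<comment> \<open>\<open>x\<close> and \<open>y\<close> share their row but not their column, so
      at least one of them is off the diagonal.\<close>
    then obtain w where w: "w \<in> ?V" "f w \<noteq> g' w"
      using xy(1-3) by metis
    show ?thesis
    proof (cases "\<exists>v\<in>?V. (g' v, f v) \<notin> ((\<lambda>v. (f v, g' v)) ` ?V)\<^sup>*")
      case True
      then obtain v where v: "v \<in> ?V" "(g' v, f v) \<notin> ((\<lambda>v. (f v, g' v)) ` ?V)\<^sup>*"
        by blast
      show ?thesis
        by (rule arc_off_cycle_imp_special[OF G max f g' _ v]) (rule r')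
    next
      case False
      then have cyc: "(g' v, f v) \<in> ((\<lambda>v. (f v, g' v)) ` ?V)\<^sup>*" if "v \<in> ?V" for v
        using that by blast
      show ?thesis
        by (rule arcs_on_cycles_imp_normal[OF G max f g' _ w]) (rule r', assumption, rule cyc)
    qed
  qed
qed

theorem theorem1:
  fixes k :: nat and G :: "'a pair_pre_digraph"
  assumes "k \<ge> 1" and "pair_graph G"
  shows "maximal_ambiguously_colorable k G \<longleftrightarrow>
    (\<exists>A \<in> carrier_mat k k. desirable A \<and> digraph_iso (with_proj G) (with_proj (mat_graph A)))"
  unfolding digraph_iso_mat_graph_iff[OF assms(2)]
proof
  assume "maximal_ambiguously_colorable k G"
  then show "\<exists>A\<in>carrier_mat k k. desirable A \<and> (\<exists>f g. represents A G f g)"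
    by (rule maximal_imp_desirable[OF assms(2)])
next
  assume "\<exists>A\<in>carrier_mat k k. desirable A \<and> (\<exists>f g. represents A G f g)"
  then obtain A f g where A: "A \<in> carrier_mat k k" and "desirable A" and rep: "represents A G f g"
    by blast
  from \<open>desirable A\<close> consider "tiny A" | "small A" | "special A" | "normal A"
    unfolding desirable_def by blast
  then show "maximal_ambiguously_colorable k G"
  proof cases
    case 1
    show ?thesis by (rule tiny_imp_maximal[OF assms(2) A 1 rep])
  next
    case 2
    show ?thesis by (rule small_imp_maximal[OF assms(2) A 2 rep])
  next
    case 3
    show ?thesis by (rule special_imp_maximal[OF assms(2) A 3 rep])
  next
    case 4
    show ?thesis by (rule normal_imp_maximal[OF assms(2) A 4 rep])
  qed
qed

end
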